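(* Let $p$ be a prime, let $\mathbf{F}$ be a field of characteristic $p$, let $G\cong \mathbf{Z}/p^2$, and let $L\cong\mathbf{Z}/p$ denote its non-trivial proper subgroup. The ring of invariants $\mathbf{F}[V_{p+1}]^G$ is generated (as an $\mathbf{F}$-algebra) by $N^G(x_p)$, $N^G(x_{p+1})$ and elements from the image of the relative transfer, $\mathrm{Tr}_L^G\left(\mathbf{F}[N^L(x_{p+1}), x_p,\ldots,x_1]\right)$.
   Context: Let $\sigma$ be a generator of $G\cong\mathbf{Z}/p^2$, so $L=\langle\sigma^p\rangle$. $V_{p+1}$ is the indecomposable $\mathbf{F}G$-module of dimension $p+1$ on which $\sigma$ acts by a single Jordan block with eigenvalue $1$. $\mathbf{F}[V_{p+1}]:=S(V_{p+1}^* )$ is the symmetric algebra on the dual, with $G$ acting by algebra automorphisms extending the action on $V_{p+1}^*$. Put $\Delta:=\sigma-1\in\mathbf{F}G$. Let $x_{p+1}$ be an $\mathbf{F}G$-module generator of $V_{p+1}^*$ and $x_i:=\Delta^{p+1-i}(x_{p+1})$ for $1\le i\le p$, so that $\{x_1,\ldots,x_{p+1}\}$ is a basis of $V_{p+1}^*$ and $\mathbf{F}[V_{p+1}]=\mathbf{F}[x_1,\ldots,x_{p+1}]$. For a subgroup $K\le G$ and $f\in\mathbf{F}[V_{p+1}]$, the norm $N^K(f)$ is the product of the elements of the $K$-orbit of $f$. In particular $N^L(x_{p+1})=x_{p+1}^p-x_1^{p-1}x_{p+1}$, and $\mathbf{F}[V_{p+1}]^L=\mathbf{F}[N^L(x_{p+1}),x_p,\ldots,x_1]$.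 The relative transfer is $\mathrm{Tr}_L^G:=\sum_{i=0}^{p-1}\sigma^i$, which maps $L$-invariants to $G$-invariants. *)

theory Defs
  imports
    "HOL-Algebra.Elementary_Groups"
    "HOL-Computational_Algebra.Computational_Algebra"
    "HOL-Library.Poly_Mapping"
    "HOL-Library.Function_Algebras"
begin

subsection \<open>Modules over a group algebra\<close>

text \<open>An \<open>FG\<close>-module is a vector space (the whole type \<open>'v\<close>, with scalar multiplication \<open>scl\<close>)
  together with a left action \<open>\<rho>\<close> of \<open>G\<close> by linear maps.\<close>

definition linear_rep ::
  "('g, 'm) monoid_scheme \<Rightarrow> ('f::field \<Rightarrow> 'v::ab_group_add \<Rightarrow> 'v) \<Rightarrow> ('g \<Rightarrow> 'v \<Rightarrow> 'v) \<Rightarrow> bool"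
  where "linear_rep G scl \<rho> \<longleftrightarrow>
    vector_space scl \<and>
    (\<forall>g\<in>carrier G. Vector_Spaces.linear scl scl (\<rho> g)) \<and>
    \<rho> \<one>\<^bsub>G\<^esub> = id \<and>
    (\<forall>g\<in>carrier G. \<forall>h\<in>carrier G. \<rho> (g \<otimes>\<^bsub>G\<^esub> h) = \<rho> g \<circ> \<rho> h)"

definition single_jordan_block ::
  "('f::field \<Rightarrow> 'v::ab_group_add \<Rightarrow> 'v) \<Rightarrow> ('v \<Rightarrow> 'v) \<Rightarrow> 'f \<Rightarrow> nat \<Rightarrow> bool"
  where "single_jordan_block scl T c n \<longleftrightarrow>
    (\<exists>e. inj_on e {1..n} \<and>
         \<not> module.dependent scl (e ` {1..n}) \<and>
         module.span scl (e ` {1..n}) = UNIV \<and>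
         (\<forall>i\<in>{1..n}. T (e i) = scl c (e i) + (if i = 1 then 0 else e (i - 1))))"

subsection \<open>The dual module\<close>

definition dual_space ::
  "('f::field \<Rightarrow> 'v::ab_group_add \<Rightarrow> 'v) \<Rightarrow> ('v \<Rightarrow> 'f) set"
  where "dual_space scl = {\<phi>. Vector_Spaces.linear scl (*) \<phi>}"

definition dual_scale :: "'f::field \<Rightarrow> ('v \<Rightarrow> 'f) \<Rightarrow> ('v \<Rightarrow> 'f)"
  where "dual_scale c \<phi> = (\<lambda>v. c * \<phi> v)"

definition dual_act ::
  "('g, 'm) monoid_scheme \<Rightarrow> ('g \<Rightarrow> 'v \<Rightarrow> 'v) \<Rightarrow> 'g \<Rightarrow> ('v \<Rightarrow> 'f) \<Rightarrow> ('v \<Rightarrow> 'f)"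
  where "dual_act G \<rho> g \<phi> = (\<lambda>v. \<phi> (\<rho> (inv\<^bsub>G\<^esub> g) v))"

text \<open>The \<open>FG\<close>-submodule generated by \<open>\<phi>\<close> is the \<open>F\<close>-span of its \<open>G\<close>-orbit.\<close>

definition dual_generator ::
  "('g, 'm) monoid_scheme \<Rightarrow> ('f::field \<Rightarrow> 'v::ab_group_add \<Rightarrow> 'v) \<Rightarrow> ('g \<Rightarrow> 'v \<Rightarrow> 'v)
     \<Rightarrow> ('v \<Rightarrow> 'f) \<Rightarrow> bool"
  where "dual_generator G scl \<rho> \<phi> \<longleftrightarrow>
    \<phi> \<in> dual_space scl \<and>
    module.span dual_scale ((\<lambda>g. dual_act G \<rho> g \<phi>) ` carrier G) = dual_space scl"

definition Delta ::
  "('g, 'm) monoid_scheme \<Rightarrow> ('g \<Rightarrow> 'v \<Rightarrow> 'v) \<Rightarrow> 'g \<Rightarrow> ('v \<Rightarrow> 'f::field) \<Rightarrow> ('v \<Rightarrow> 'f)"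
  where "Delta G \<rho> \<sigma> \<phi> = dual_act G \<rho> \<sigma> \<phi> - \<phi>"

subsection \<open>The symmetric algebra on the dual\<close>

text \<open>A polynomial maps monomials (exponent vectors) to coefficients, with finite support.
  Variables are indexed by all of \<open>nat\<close>; \<open>poly_ring n\<close> is the polynomial ring
  in the variables with indices \<open>1, \<dots>, n\<close>.\<close>

type_synonym 'f polynomial = "(nat \<Rightarrow>\<^sub>0 nat) \<Rightarrow>\<^sub>0 'f"

definition Const :: "'f::field \<Rightarrow> 'f polynomial"
  where "Const c = Poly_Mapping.single 0 c"

definition X :: "nat \<Rightarrow> 'f::field polynomial"
  where "X i = Poly_Mapping.single (Poly_Mapping.single i 1) 1"

definition poly_ring :: "nat \<Rightarrow> 'f::field polynomial set"
  where "poly_ring n = {f. \<forall>m\<in>Poly_Mapping.keys f. Poly_Mapping.keys m \<subseteq> {1..n}}"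

definition poly_subst :: "(nat \<Rightarrow> 'f::field polynomial) \<Rightarrow> 'f polynomial \<Rightarrow> 'f polynomial"
  where "poly_subst h f =
    (\<Sum>m\<in>Poly_Mapping.keys f.
       Const (Poly_Mapping.lookup f m) *
       (\<Prod>i\<in>Poly_Mapping.keys m. h i ^ Poly_Mapping.lookup m i))"

text \<open>Given a basis \<open>x 1, \<dots>, x n\<close> of \<open>V\<^sup>*\<close>, the symmetric algebra \<open>S(V\<^sup>*)\<close> is
  \<open>poly_ring n\<close>, with \<open>V\<^sup>*\<close> embedded by the linear map \<open>sym_emb n x\<close> sending \<open>x i\<close> to \<open>X i\<close>.\<close>

definition sym_emb :: "nat \<Rightarrow> (nat \<Rightarrow> 'v \<Rightarrow> 'f::field) \<Rightarrow> ('v \<Rightarrow> 'f) \<Rightarrow> 'f polynomial"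
  where "sym_emb n x \<phi> =
    (\<Sum>i=1..n. Const (module.representation dual_scale (x ` {1..n}) \<phi> (x i)) * X i)"

text \<open>The algebra endomorphism of \<open>S(V\<^sup>*)\<close> that extends the action of \<open>g\<close> on \<open>V\<^sup>*\<close>.\<close>

definition sym_act ::
  "('g, 'm) monoid_scheme \<Rightarrow> ('g \<Rightarrow> 'v \<Rightarrow> 'v) \<Rightarrow> nat \<Rightarrow> (nat \<Rightarrow> 'v \<Rightarrow> 'f::field)
     \<Rightarrow> 'g \<Rightarrow> 'f polynomial \<Rightarrow> 'f polynomial"
  where "sym_act G \<rho> n x g = poly_subst (\<lambda>i. sym_emb n x (dual_act G \<rho> g (x i)))"

subsection \<open>Invariants, norms, transfer, generated subalgebras\<close>

text \<open>In the following, \<open>act\<close> is an action on polynomials such as \<open>sym_act G \<rho> n x\<close>.\<close>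

definition invariants ::
  "('g \<Rightarrow> 'f polynomial \<Rightarrow> 'f polynomial) \<Rightarrow> nat \<Rightarrow> 'g set \<Rightarrow> 'f::field polynomial set"
  where "invariants act n K = {f \<in> poly_ring n. \<forall>g\<in>K. act g f = f}"

text \<open>The product runs over the orbit as a set: repeated elements are counted once.\<close>

definition orbit_norm ::
  "('g \<Rightarrow> 'f polynomial \<Rightarrow> 'f polynomial) \<Rightarrow> 'g set \<Rightarrow> 'f::field polynomial \<Rightarrow> 'f polynomial"
  where "orbit_norm act K f = \<Prod> ((\<lambda>g. act g f) ` K)"

definition rel_transfer ::
  "('g, 'm) monoid_scheme \<Rightarrow> ('g \<Rightarrow> 'f polynomial \<Rightarrow> 'f polynomial) \<Rightarrow> nat \<Rightarrow> 'g
     \<Rightarrow> 'f::field polynomial \<Rightarrow> 'f polynomial"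
  where "rel_transfer G act p \<sigma> f = (\<Sum>i<p. act (\<sigma> [^]\<^bsub>G\<^esub> i) f)"

inductive_set alg_gen :: "'f::field polynomial set \<Rightarrow> 'f polynomial set"
  for S :: "'f polynomial set"
  where
    const: "Const c \<in> alg_gen S"
  | incl: "f \<in> S \<Longrightarrow> f \<in> alg_gen S"
  | add: "f \<in> alg_gen S \<Longrightarrow> g \<in> alg_gen S \<Longrightarrow> f + g \<in> alg_gen S"
  | mult: "f \<in> alg_gen S \<Longrightarrow> g \<in> alg_gen S \<Longrightarrow> f * g \<in> alg_gen S"

end

theory Submission
  imports "HOL-Algebra.Multiplicative_Group" Defs
begin

text \<open>Let \<open>B\<close> be the polynomial ring in \<open>x 1, \<dots>, x p\<close>, let \<open>t = x (p + 1)\<close>, and let \<open>N\<close>, \<open>M\<close>, \<open>Q\<close> be the norm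
  of \<open>t\<close> for \<open>L\<close>, the norm of \<open>x p\<close> for \<open>G\<close> and the norm of \<open>t\<close> for \<open>G\<close>. Invariants are analysed by their leading
  coefficients, one step for \<open>L\<close> and one for \<open>G / L\<close>, and both steps are instances of the lemma
  \<open>invariant_by_leading_coefficients\<close>.

  The generator \<open>\<sigma> ^ p\<close> of \<open>L\<close> fixes \<open>B\<close> and maps \<open>t\<close> to \<open>t + x 1\<close>. Let an \<open>L\<close>-invariant have degree \<open>d\<close> and leading
  coefficient \<open>a\<close> in \<open>t\<close>. Comparing coefficients of degree \<open>d - 1\<close> gives \<open>d a x 1 = 0\<close>, so \<open>p\<close> divides \<open>d\<close>, and
  subtracting \<open>a N ^ (d / p)\<close> lowers the degree. Hence the \<open>L\<close>-invariants are the polynomials in \<open>N\<close> over \<open>B\<close>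
  (lemma \<open>funpow_p_invariants\<close>).

  On these, \<open>\<sigma>\<close> maps \<open>N\<close> to \<open>N + c\<close> with \<open>c = (x p) ^ p - (x 1) ^ (p - 1) x p\<close> in \<open>B\<close>. The key is the action on \<open>B\<close>:
  the linear forms \<open>x p, \<sigma> (x p), \<dots>, \<sigma> ^ (p - 1) (x p)\<close> are a basis permuted cyclically by \<open>\<sigma>\<close>, so \<open>\<sigma>\<close> permutes the
  monomials in them. The fixed monomials are the powers of \<open>M\<close>, and all other orbits have \<open>p\<close> elements and transfers
  as their sums. Two facts follow.

  \<^item> Every invariant in \<open>B\<close> is a polynomial in \<open>M\<close> plus a transfer from \<open>B\<close> (lemma
    \<open>invariant_eq_norm_plus_transfer\<close>).
  \<^item> If \<open>\<alpha>\<close> is a nonzero polynomial in \<open>M\<close>, then \<open>\<alpha> c\<close> is not of the form \<open>\<beta> - \<sigma> \<beta>\<close> with \<open>\<beta>\<close> in \<open>B\<close> (lemma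
    \<open>norm_polynomial_not_coboundary\<close>): the latter have coefficient zero at all powers of \<open>M\<close>, whereas \<open>c\<close> has
    constant term zero and coefficient \<open>- (p - 1)!\<close> at \<open>M\<close>.

  Now let \<open>f\<close> be a \<open>G\<close>-invariant of degree \<open>d\<close> in \<open>N\<close> with leading coefficient \<open>a\<close>. By the first fact \<open>a\<close> is a polynomial
  \<open>\<alpha>\<close> in \<open>M\<close> plus the transfer of some \<open>b\<close>, and after subtracting the transfer of \<open>b N ^ d\<close> it is \<open>\<alpha>\<close>. If \<open>p\<close> divides \<open>d\<close>,
  subtracting \<open>\<alpha> Q ^ (d / p)\<close> lowers the degree. Otherwise the coefficients of degree \<open>d - 1\<close> show that
  \<open>d \<alpha> c\<close> has the form \<open>\<beta> - \<sigma> \<beta>\<close>, so \<open>\<alpha> = 0\<close> by the second fact. By induction \<open>f\<close> lies in the algebra generated by \<open>M\<close>,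
  \<open>Q\<close> and the transfers (lemma \<open>invariants_eq\<close>).\<close>

(* coeff and monom are to mean the operations on the type of univariate polynomials. *)
hide_const (open) up_ring.coeff up_ring.monom

section \<open>Endomorphisms, subrings and leading coefficients\<close>

locale ring_endo =
  fixes s :: "'a::comm_ring_1 \<Rightarrow> 'a"
  assumes add: "s (a + b) = s a + s b"
    and mult: "s (a * b) = s a * s b"
    and one [simp]: "s 1 = 1"
begin

lemma zero [simp]: "s 0 = 0"
  using add[of 0 0] by simp

lemma uminus: "s (- a) = - s a"
  using add[of a "- a"] by (simp add: eq_neg_iff_add_eq_0 add.commute)

lemma diff: "s (a - b) = s a - s b"
  using add[of a "- b"] by (simp add: uminus)

lemma sum: "s (\<Sum>i\<in>I. f i) = (\<Sum>i\<in>I. s (f i))"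
  by (induction I rule: infinite_finite_induct) (auto simp: add)

lemma prod: "s (\<Prod>i\<in>I. f i) = (\<Prod>i\<in>I. s (f i))"
  by (induction I rule: infinite_finite_induct) (auto simp: mult)

lemma power: "s (a ^ n) = s a ^ n"
  by (induction n) (auto simp: mult)

lemma of_nat [simp]: "s (of_nat n) = of_nat n"
  by (induction n) (auto simp: add)

lemma poly: "s (poly P u) = poly (map_poly s P) (s u)"
  by (induction P) (auto simp: map_poly_pCons add mult)

lemma funpow: "ring_endo (s ^^ n)"
proof (induction n)
  case (Suc n)
  then interpret n: ring_endo "s ^^ n" .
  show ?case by unfold_locales (auto simp: add mult n.add n.mult)
qed (unfold_locales, auto)

end

locale unital_subring =
  fixes B :: "'a::comm_ring_1 set"
  assumes one [simp]: "1 \<in> B"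
    and diff [intro]: "a \<in> B \<Longrightarrow> b \<in> B \<Longrightarrow> a - b \<in> B"
    and mult [intro]: "a \<in> B \<Longrightarrow> b \<in> B \<Longrightarrow> a * b \<in> B"
begin

lemma zero [simp]: "0 \<in> B"
  using diff[OF one one] by simp

lemma uminus [intro]: "a \<in> B \<Longrightarrow> - a \<in> B"
  using diff[OF zero] by simp

lemma add [intro]: "a \<in> B \<Longrightarrow> b \<in> B \<Longrightarrow> a + b \<in> B"
  using diff[of a "- b"] by auto

lemma sum [intro]: "(\<And>i. i \<in> I \<Longrightarrow> f i \<in> B) \<Longrightarrow> (\<Sum>i\<in>I. f i) \<in> B"
  by (induction I rule: infinite_finite_induct) auto

lemma prod [intro]: "(\<And>i. i \<in> I \<Longrightarrow> f i \<in> B) \<Longrightarrow> (\<Prod>i\<in>I. f i) \<in> B"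
  by (induction I rule: infinite_finite_induct) auto

lemma power [intro]: "a \<in> B \<Longrightarrow> a ^ n \<in> B"
  by (induction n) auto

lemma of_nat [simp, intro]: "of_nat n \<in> B"
  by (induction n) auto

end

definition polys_over :: "'a::comm_ring_1 set \<Rightarrow> 'a poly set"
  where "polys_over B = {P. \<forall>i. coeff P i \<in> B}"

lemma polys_overD: "P \<in> polys_over B \<Longrightarrow> coeff P i \<in> B"
  by (simp add: polys_over_def)

context unital_subring begin

lemma polys_over_subring: "unital_subring (polys_over B)"
proof
  fix P Q :: "'a poly"
  assume PQ: "P \<in> polys_over B" "Q \<in> polys_over B"
  then show "P - Q \<in> polys_over B"
    by (auto simp: polys_over_def)
  show "P * Q \<in> polys_over B"
    using PQ coeff_mult_semiring_closed[of B P Q] by (auto simp: polys_over_def)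
qed (auto simp: polys_over_def coeff_1)

lemma pCons_polys_over: "a \<in> B \<Longrightarrow> P \<in> polys_over B \<Longrightarrow> pCons a P \<in> polys_over B"
  by (auto simp: polys_over_def coeff_pCons split: nat.split)

lemma smult_polys_over: "a \<in> B \<Longrightarrow> P \<in> polys_over B \<Longrightarrow> smult a P \<in> polys_over B"
  by (auto simp: polys_over_def)

lemma pcompose_polys_over: 
  "P \<in> polys_over B \<Longrightarrow> Q \<in> polys_over B \<Longrightarrow> pcompose P Q \<in> polys_over B"
  using coeff_pcompose_semiring_closed[of B P Q] by (auto simp: polys_over_def)

end

lemma zero_polys_over [simp]: "0 \<in> B \<Longrightarrow> 0 \<in> polys_over B"
  by (auto simp: polys_over_def)

definition transcendental_over :: "'a::comm_ring_1 set \<Rightarrow> 'a \<Rightarrow> bool"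
  where "transcendental_over B u \<longleftrightarrow> (\<forall>P\<in>polys_over B. poly P u = 0 \<longrightarrow> P = 0)"

lemma transcendental_over_eq:
  assumes "transcendental_over B u" "unital_subring B"
    "P \<in> polys_over B" "Q \<in> polys_over B" "poly P u = poly Q u"
  shows "P = Q"
proof -
  interpret C: unital_subring "polys_over B"
    using unital_subring.polys_over_subring[OF assms(2)] .
  have "P - Q \<in> polys_over B" using assms by auto
  with assms(1,5) have "P - Q = 0" unfolding transcendental_over_def
    by (metis poly_diff right_minus_eq)
  then show ?thesis by simp
qed

text \<open>\<open>P (q u) = (P \<circ> q) u\<close>, and over a domain composing with a
  nonconstant \<open>q\<close> kills no polynomial.\<close>

lemma transcendental_over_poly:
  fixes u :: "'a::idom"
  assumes "transcendental_over B u" "unital_subring B" "q \<in> polys_over B" "degree q > 0"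
  shows "transcendental_over B (poly q u)"
  unfolding transcendental_over_def
proof (intro ballI impI)
  fix P assume P: "P \<in> polys_over B" "poly P (poly q u) = 0"
  have "pcompose P q \<in> polys_over B"
    using assms P by (intro unital_subring.pcompose_polys_over)
  moreover have "poly (pcompose P q) u = 0" using P by (simp add: poly_pcompose)
  ultimately have "pcompose P q = 0" using assms(1) by (auto simp: transcendental_over_def)
  then show "P = 0" using assms(4) pcompose_eq_0 by blast
qed

text \<open>Replacing the variable by its translate by \<open>c\<close> keeps the top
  coefficient and changes the next one by \<open>c\<close> times the top coefficient of the
  derivative. The factor \<open>Suc d\<close> is what distinguishes the degrees divisible by the
  characteristic.\<close>

lemma coeff_pcompose_translation:
  fixes P :: "'a::comm_ring_1 poly"
  assumes "degree P \<le> Suc d"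
  shows "coeff (pcompose P [:c, 1:]) (Suc d) = coeff P (Suc d)"
    "coeff (pcompose P [:c, 1:]) d = coeff P d + of_nat (Suc d) * (c * coeff P (Suc d))"
proof -
  have top: "coeff (pcompose P [:c, 1:]) n = coeff P n" if "degree P \<le> n" for n P
    using that
  proof (induction P arbitrary: n)
    case (pCons a P)
    show ?case
    proof (cases "P = 0")
      case False
      then obtain m where m: "n = Suc m" "degree P \<le> m" using pCons.prems by (cases n) auto
      then show ?thesis using pCons.IH[of m] pCons.IH[of n]
        by (simp add: pcompose_pCons coeff_eq_0)
    qed (simp add: pcompose_pCons)
  qed auto
  show "coeff (pcompose P [:c, 1:]) (Suc d) = coeff P (Suc d)" using assms by (rule top)
  show "coeff (pcompose P [:c, 1:]) d = coeff P d + of_nat (Suc d) * (c * coeff P (Suc d))"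
    using assms
  proof (induction P arbitrary: d)
    case (pCons a P)
    have "degree P \<le> d" using pCons.prems by (cases "P = 0") auto
    show ?case
    proof (cases d)
      case 0
      then show ?thesis using \<open>degree P \<le> d\<close>
        by (auto simp: pcompose_pCons coeff_pCons elim!: degree_eq_zeroE)
    next
      case (Suc m)
      with \<open>degree P \<le> d\<close> have "degree P \<le> Suc m" by simp
      from pCons.IH[OF this] top[OF this] Suc show ?thesis
        by (simp add: pcompose_pCons algebra_simps)
    qed
  qed auto
qed

text \<open>An invariant \<open>P u\<close> of degree \<open>d\<close> has an invariant leading
  coefficient, which \<open>lift\<close> allows to move into \<open>K\<close> by subtracting an
  element of \<open>S\<close>. If \<open>p\<close> divides \<open>d\<close>, the remaining
  leading term \<open>\<alpha> u ^ d\<close> is that of \<open>\<alpha> q ^ (d / p)\<close>,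
  which lies in \<open>S\<close> too. Otherwise the coefficients of degree \<open>d - 1\<close>
  in \<open>s (P u) = P u\<close> show that \<open>d \<alpha> c\<close> has the form
  \<open>\<beta> - s \<beta>\<close>, and \<open>obstruction\<close> gives \<open>\<alpha> =
  0\<close>. In both cases the degree has dropped.\<close>

lemma invariant_by_leading_coefficients:
  fixes s :: "'a::idom \<Rightarrow> 'a"
  assumes "ring_endo s" and "unital_subring B" and sB: "\<And>b. b \<in> B \<Longrightarrow> s b \<in> B"
    and u: "transcendental_over B u" "s u = u + c" "c \<in> B"
    and char: "CHAR('a) = p" "p > 0"
    and q: "q \<in> polys_over B" "degree q = p" "lead_coeff q = 1" "s (poly q u) = poly q u"
    and S: "0 \<in> S" "poly q u \<in> S" "\<And>a b. a \<in> S \<Longrightarrow> b \<in> S \<Longrightarrow> a + b \<in> S"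
      "\<And>a b. a \<in> S \<Longrightarrow> b \<in> S \<Longrightarrow> a * b \<in> S"
    and K: "K \<subseteq> B \<inter> S" "\<And>\<alpha>. \<alpha> \<in> K \<Longrightarrow> s \<alpha> = \<alpha>" "\<And>n \<alpha>. \<alpha> \<in> K \<Longrightarrow> of_nat n * \<alpha> \<in> K"
    and lift: "\<And>b d. b \<in> B \<Longrightarrow> s b = b \<Longrightarrow> \<exists>\<alpha>\<in>K. \<exists>R\<in>polys_over B. degree R \<le> d \<and>
      coeff R d = b - \<alpha> \<and> s (poly R u) = poly R u \<and> poly R u \<in> S"
    and obstruction: "\<And>\<alpha> \<beta>. \<alpha> \<in> K \<Longrightarrow> \<beta> \<in> B \<Longrightarrow> \<alpha> * c = \<beta> - s \<beta> \<Longrightarrow> \<alpha> = 0"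
    and P: "P \<in> polys_over B" "s (poly P u) = poly P u"
  shows "poly P u \<in> S"
proof -
  interpret s: ring_endo s by fact
  interpret B: unital_subring B by fact
  interpret BX: unital_subring "polys_over B" by (rule B.polys_over_subring)
  have shift: "pcompose (map_poly s P) [:c, 1:] = P"
    if "P \<in> polys_over B" "s (poly P u) = poly P u" for P
  proof (rule transcendental_over_eq[OF u(1) B.unital_subring_axioms])
    show "pcompose (map_poly s P) [:c, 1:] \<in> polys_over B"
      using that u(3) sB by (intro B.pcompose_polys_over B.pCons_polys_over)
        (auto simp: polys_over_def coeff_map_poly)
    show "poly (pcompose (map_poly s P) [:c, 1:]) u = poly P u"
      using that u(2) by (simp add: poly_pcompose s.poly add.commute)
  qed (use that in auto)
  have "\<forall>P\<in>polys_over B. s (poly P u) = poly P u \<longrightarrow> (\<forall>k\<ge>n. coeff P k = 0) \<longrightarrow> poly P u \<in> S" for n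
  proof (induction n)
    case 0
    have "P = 0" if "\<forall>k\<ge>0. coeff P k = 0" for P :: "'a poly"
      using that by (simp add: poly_eq_iff)
    then show ?case using S by fastforce
  next
    case (Suc d)
    show ?case
    proof (intro ballI impI)
      fix P assume P: "P \<in> polys_over B" "s (poly P u) = poly P u" "\<forall>k\<ge>Suc d. coeff P k = 0"
      have deg: "degree P \<le> d" using P(3) by (intro degree_le) auto
      have degs: "degree (map_poly s P) \<le> d" using deg map_poly_degree_leq order.trans by blast
      have "coeff (pcompose (map_poly s P) [:c, 1:]) d = coeff (map_poly s P) d"
      proof (cases d)
        case 0
        with degs show ?thesis by (auto elim: degree_eq_zeroE)
      next
        case (Suc m)
        with degs show ?thesis using coeff_pcompose_translation(1)[of "map_poly s P" m] by simp
      qed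
      with shift[OF P(1,2)] have sb: "s (coeff P d) = coeff P d" by (simp add: coeff_map_poly)
      obtain \<alpha> R where \<alpha>: "\<alpha> \<in> K" and R: "R \<in> polys_over B" "degree R \<le> d"
        "coeff R d = coeff P d - \<alpha>" "s (poly R u) = poly R u" "poly R u \<in> S"
        using lift[OF polys_overD[OF P(1)] sb, of d] by blast
      have \<alpha>B: "\<alpha> \<in> B" "\<alpha> \<in> S" "s \<alpha> = \<alpha>" using \<alpha> K by auto
      define P' where "P' = P - R"
      have P': "P' \<in> polys_over B" "s (poly P' u) = poly P' u" "degree P' \<le> d" "coeff P' d = \<alpha>"
        using P R deg by (auto simp: P'_def s.diff intro: degree_diff_le)
      have "poly P' u \<in> S"
      proof (cases "p dvd d")
        case True
        then obtain m where m: "d = p * m" by auto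
        define T where "T = P' - smult \<alpha> (q ^ m)"
        have q0: "q \<noteq> 0" using q(3) by auto
        have dq: "degree (q ^ m) = d" using q q0 by (simp add: degree_power_eq m)
        have lq: "coeff (q ^ m) d = 1" using q(3) lead_coeff_power[of q m] dq by simp
        have "T \<in> polys_over B"
          using P' q \<alpha>B by (auto simp: T_def intro!: B.smult_polys_over)
        moreover have "s (poly T u) = poly T u"
          using P' q \<alpha>B by (simp add: T_def s.diff s.mult s.power)
        moreover have "coeff T k = 0" if "k \<ge> d" for k
        proof (cases "k = d")
          case False
          then show ?thesis using that P'(3) dq by (auto simp: T_def coeff_eq_0)
        qed (use P' lq in \<open>auto simp: T_def\<close>)
        ultimately have "poly T u \<in> S" using Suc.IH by blast
        moreover have "\<alpha> * poly q u ^ m \<in> S"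
        proof (induction m)
          case (Suc k)
          then show ?case using S(4)[OF S(2) Suc] by (simp add: ac_simps)
        qed (use \<alpha>B in auto)
        moreover have "poly P' u = poly T u + \<alpha> * poly q u ^ m" by (simp add: T_def)
        ultimately show ?thesis using S by metis
      next
        case False
        then obtain m where m: "d = Suc m" by (cases d) auto
        have "degree (map_poly s P') \<le> Suc m" using P'(3) m map_poly_degree_leq order.trans by metis
        from coeff_pcompose_translation(2)[OF this, of c] shift[OF P'(1,2)]
        have "coeff P' m = s (coeff P' m) + of_nat d * (c * \<alpha>)"
          using P' m \<alpha>B by (simp add: coeff_map_poly)
        then have "of_nat d * \<alpha> * c = coeff P' m - s (coeff P' m)"
          by (simp add: algebra_simps)
        then have "of_nat d * \<alpha> = 0"
          using obstruction K(3)[OF \<alpha>] polys_overD[OF P'(1)] by blast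
        moreover have "of_nat d \<noteq> (0::'a)" using False char by (simp add: of_nat_eq_0_iff_char_dvd)
        ultimately have "\<alpha> = 0" by simp
        then have "coeff P' k = 0" if "k \<ge> d" for k
          using P' that by (cases "k = d") (auto simp: coeff_eq_0)
        then show ?thesis using Suc.IH P' by blast
      qed
      then have "poly P' u + poly R u \<in> S" using R S by blast
      then show "poly P u \<in> S" by (simp add: P'_def)
    qed
  qed
  from this[of "Suc (degree P)"] P show ?thesis by (auto simp: coeff_eq_0)
qed

section \<open>The polynomial ring\<close>

abbreviation (input) lookup where "lookup \<equiv> Poly_Mapping.lookup"
abbreviation (input) keys where "keys \<equiv> Poly_Mapping.keys"

lemma Const_hom [simp]:
  "Const 0 = 0" "Const 1 = 1" "Const (a + b) = Const a + Const b" "Const (a * b) = Const a * Const b"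
  "Const (- a) = - Const a"
  by (auto simp: Const_def single_add mult_single single_uminus)

lemma Const_eq_0_iff [simp]: "Const a = 0 \<longleftrightarrow> a = 0"
  unfolding Const_def by (metis lookup_single_eq lookup_zero single_zero)

lemma of_nat_eq_Const: "of_nat n = (Const (of_nat n) :: 'f::field polynomial)"
  by (induction n) auto

lemma CHAR_polynomial: "CHAR('f::field polynomial) = CHAR('f)"
  by (rule CHAR_eqI) (auto simp: of_nat_eq_Const of_nat_eq_0_iff_char_dvd)

lemma sum_of_monomials: "(\<Sum>m\<in>keys f. Poly_Mapping.single m (lookup f m)) = f"
  by (rule poly_mapping_eqI) (auto simp: lookup_sum lookup_single when_def in_keys_iff)

lemma mult_as_sum_of_monomials:
  fixes f g :: "'f::field polynomial"
  shows "f * g = (\<Sum>m\<in>keys f. \<Sum>n\<in>keys g. Poly_Mapping.single (m + n) (lookup f m * lookup g n))"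
proof -
  have "f * g = (\<Sum>m\<in>keys f. Poly_Mapping.single m (lookup f m)) *
      (\<Sum>n\<in>keys g. Poly_Mapping.single n (lookup g n))"
    by (simp add: sum_of_monomials)
  then show ?thesis by (simp add: sum_product mult_single)
qed

section \<open>Substitution\<close>

definition eval_monomial :: "(nat \<Rightarrow> 'f::field polynomial) \<Rightarrow> (nat \<Rightarrow>\<^sub>0 nat) \<Rightarrow> 'f polynomial"
  where "eval_monomial h m = (\<Prod>i\<in>keys m. h i ^ lookup m i)"

lemma eval_monomial_superset:
  "finite I \<Longrightarrow> keys m \<subseteq> I \<Longrightarrow> eval_monomial h m = (\<Prod>i\<in>I. h i ^ lookup m i)"
  unfolding eval_monomial_def by (rule prod.mono_neutral_left) (auto simp: in_keys_iff)

lemma eval_monomial_add: "eval_monomial h (m + n) = eval_monomial h m * eval_monomial h n"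
proof -
  let ?I = "keys m \<union> keys n"
  have "eval_monomial h (m + n) = (\<Prod>i\<in>?I. h i ^ lookup (m + n) i)"
    using keys_add[of m n] by (intro eval_monomial_superset) auto
  also have "\<dots> = (\<Prod>i\<in>?I. h i ^ lookup m i) * (\<Prod>i\<in>?I. h i ^ lookup n i)"
    by (simp add: lookup_add power_add prod.distrib)
  also have "\<dots> = eval_monomial h m * eval_monomial h n"
    by (simp add: eval_monomial_superset[of ?I])
  finally show ?thesis .
qed

lemma poly_subst_superset:
  assumes "finite M" "keys f \<subseteq> M"
  shows "poly_subst h f = (\<Sum>m\<in>M. Const (lookup f m) * eval_monomial h m)"
  unfolding poly_subst_def eval_monomial_def
  using assms by (intro sum.mono_neutral_left) (auto simp: in_keys_iff)

lemma poly_subst_single: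
  "poly_subst h (Poly_Mapping.single m c) = Const c * eval_monomial h m"
  by (subst poly_subst_superset[of "{m}"]) auto

lemma poly_subst_add: "poly_subst h (f + g) = poly_subst h f + poly_subst h g"
proof -
  let ?M = "keys f \<union> keys g"
  have "poly_subst h (f + g) = (\<Sum>m\<in>?M. Const (lookup (f + g) m) * eval_monomial h m)"
    using keys_add[of f g] by (intro poly_subst_superset) auto
  also have "\<dots> = (\<Sum>m\<in>?M. Const (lookup f m) * eval_monomial h m) +
      (\<Sum>m\<in>?M. Const (lookup g m) * eval_monomial h m)"
    by (simp add: lookup_add sum.distrib algebra_simps)
  also have "\<dots> = poly_subst h f + poly_subst h g"
    by (simp add: poly_subst_superset[of ?M])
  finally show ?thesis .
qed

lemma poly_subst_sum: "poly_subst h (\<Sum>i\<in>I. f i) = (\<Sum>i\<in>I. poly_subst h (f i))"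
  by (induction I rule: infinite_finite_induct) 
    (auto simp: poly_subst_add poly_subst_superset[of "{}"])

lemma poly_subst_mult: "poly_subst h (f * g) = poly_subst h f * poly_subst h g"
proof -
  have "poly_subst h (f * g) = (\<Sum>m\<in>keys f. \<Sum>n\<in>keys g.
      (Const (lookup f m) * eval_monomial h m) * (Const (lookup g n) * eval_monomial h n))"
    by (simp add: mult_as_sum_of_monomials[of f g] poly_subst_sum poly_subst_single eval_monomial_add ac_simps)
  then show ?thesis
    by (simp add: sum_product poly_subst_superset[of "keys f" f] poly_subst_superset[of "keys g" g])
qed

lemma poly_subst_Const [simp]: "poly_subst h (Const c) = Const c"
  unfolding Const_def[of c] poly_subst_single by (simp add: eval_monomial_def Const_def)

lemma poly_subst_X [simp]: "poly_subst h (X i) = h i"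
  unfolding X_def poly_subst_single by (simp add: eval_monomial_def)

locale alg_endo = ring_endo s for s :: "'f::field polynomial \<Rightarrow> 'f polynomial" +
  assumes Const [simp]: "s (Const c) = Const c"
begin

lemma poly_subst: "s (poly_subst h f) = poly_subst (\<lambda>i. s (h i)) f"
  unfolding poly_subst_def by (simp add: sum mult prod power)

lemma alg_gen_image: "f \<in> alg_gen S \<Longrightarrow> s f \<in> alg_gen (s ` S)"
  by (induction rule: alg_gen.induct)
    (simp_all add: add mult alg_gen.const alg_gen.incl alg_gen.add alg_gen.mult)

lemma alg_endo_funpow: "alg_endo (s ^^ n)"
proof -
  interpret n: ring_endo "s ^^ n" by (rule funpow)
  show ?thesis by unfold_locales (induction n, auto)
qed

end

lemma alg_endo_poly_subst: "alg_endo (poly_subst h)"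
  using poly_subst_Const[of h 1] by unfold_locales (simp_all add: poly_subst_add poly_subst_mult)

lemma alg_endo_comp: "alg_endo s \<Longrightarrow> alg_endo r \<Longrightarrow> alg_endo (s \<circ> r)"
  by (simp add: alg_endo_def ring_endo_def alg_endo_axioms_def)

lemma alg_endo_id: "alg_endo (\<lambda>f. f)"
  by unfold_locales auto

lemma eval_monomial_X: "eval_monomial X m = (Poly_Mapping.single m 1 :: 'f::field polynomial)"
proof (induction m rule: Poly_Mapping.update_induct)
  case (update m a b)
  have "Poly_Mapping.update a b m = m + Poly_Mapping.single a b"
    using update by (intro poly_mapping_eqI)
      (auto simp: lookup_update lookup_add lookup_single in_keys_iff when_def)
  moreover have "eval_monomial X (Poly_Mapping.single a b) =
      (Poly_Mapping.single (Poly_Mapping.single a b) 1 :: 'f polynomial)"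
  proof -
    have "X a ^ b = (Poly_Mapping.single (Poly_Mapping.single a b) 1 :: 'f polynomial)"
      by (induction b) (auto simp: X_def mult_single simp flip: single_add)
    then show ?thesis using update by (simp add: eval_monomial_def)
  qed
  ultimately show ?case using update by (simp add: eval_monomial_add mult_single)
qed (simp add: eval_monomial_def)

lemma poly_subst_self: "poly_subst X f = f"
  unfolding poly_subst_superset[OF finite_keys order.refl] eval_monomial_X
  by (subst (3) sum_of_monomials[symmetric]) (simp add: Const_def mult_single)

section \<open>Polynomials in an initial segment of the variables\<close>

lemma poly_ring_subring: "unital_subring (poly_ring n :: 'f::field polynomial set)"
proof
  fix f g :: "'f polynomial" assume fg: "f \<in> poly_ring n" "g \<in> poly_ring n"
  have "keys (f - g) \<subseteq> keys f \<union> keys g" by (auto simp: in_keys_iff lookup_minus)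
  with fg show "f - g \<in> poly_ring n" unfolding poly_ring_def by blast
  show "f * g \<in> poly_ring n" unfolding poly_ring_def
  proof (intro CollectI ballI)
    fix m assume "m \<in> keys (f * g)"
    then obtain a b where "m = a + b" "a \<in> keys f" "b \<in> keys g" using keys_mult[of f g] by blast
    with fg keys_add[of a b] show "keys m \<subseteq> {1..n}" unfolding poly_ring_def by fastforce
  qed
qed (auto simp: poly_ring_def)

lemma Const_poly_ring [simp]: "Const c \<in> poly_ring n"
  by (auto simp: poly_ring_def Const_def)

lemma X_poly_ring: "i \<in> {1..n} \<Longrightarrow> X i \<in> poly_ring n"
  by (auto simp: poly_ring_def X_def)

lemma poly_ring_mono: "m \<le> n \<Longrightarrow> poly_ring m \<subseteq> poly_ring n"
  by (fastforce simp: poly_ring_def)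

lemma poly_subst_cong:
  assumes "f \<in> poly_ring n" "\<And>i. i \<in> {1..n} \<Longrightarrow> h i = h' i"
  shows "poly_subst h f = poly_subst h' f"
proof -
  have "i \<in> {1..n}" if "m \<in> keys f" "i \<in> keys m" for m i
    using assms(1) that unfolding poly_ring_def by blast
  then show ?thesis unfolding poly_subst_def using assms(2)
    by (intro sum.cong arg_cong2[where f = "(*)"] prod.cong) auto
qed

lemma alg_endo_eqI:
  assumes "alg_endo s" "alg_endo r" "f \<in> poly_ring n" "\<And>i. i \<in> {1..n} \<Longrightarrow> s (X i) = r (X i)"
  shows "s f = r f"
proof -
  have "s f = poly_subst (\<lambda>i. s (X i)) f"
    using alg_endo.poly_subst[OF assms(1), of X f] by (simp add: poly_subst_self)
  also have "\<dots> = poly_subst (\<lambda>i. r (X i)) f" using assms by (intro poly_subst_cong) auto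
  also have "\<dots> = r f"
    using alg_endo.poly_subst[OF assms(2), of X f] by (simp add: poly_subst_self)
  finally show ?thesis .
qed

lemma poly_subst_closed:
  assumes "f \<in> poly_ring n" "unital_subring C" "\<And>c. Const c \<in> C" "\<And>i. i \<in> {1..n} \<Longrightarrow> h i \<in> C"
  shows "poly_subst h f \<in> C"
proof -
  interpret unital_subring C by fact
  have "i \<in> {1..n}" if "m \<in> keys f" "i \<in> keys m" for m i
    using assms(1) that unfolding poly_ring_def by blast
  then show ?thesis unfolding poly_subst_def using assms
    by (intro sum mult prod power) auto
qed

lemma alg_endo_closed:
  assumes "alg_endo s" "f \<in> poly_ring n" "\<And>i. i \<in> {1..n} \<Longrightarrow> s (X i) \<in> poly_ring k"
  shows "s f \<in> poly_ring k"
proof -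
  have "s f = poly_subst (\<lambda>i. s (X i)) f"
    using alg_endo.poly_subst[OF assms(1), of X f] by (simp add: poly_subst_self)
  then show ?thesis using assms poly_subst_closed[OF assms(2) poly_ring_subring] by simp
qed

lemma alg_gen_subring: "unital_subring (alg_gen S)"
proof
  show "1 \<in> alg_gen S" using alg_gen.const[of 1 S] by simp
  fix f g assume "f \<in> alg_gen S" "g \<in> alg_gen S"
  then show "f * g \<in> alg_gen S" by (rule alg_gen.mult)
  have "f + Const (-1) * g \<in> alg_gen S"
    using \<open>f \<in> alg_gen S\<close> \<open>g \<in> alg_gen S\<close> by (intro alg_gen.add alg_gen.mult alg_gen.const)
  moreover have "Const (-1) * g = - g"
    unfolding Const_hom(5) by simp
  ultimately show "f - g \<in> alg_gen S" by simp
qed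

lemma alg_gen_minimal:
  assumes "unital_subring C" "\<And>c. Const c \<in> C" "S \<subseteq> C"
  shows "alg_gen S \<subseteq> C"
proof
  interpret unital_subring C by fact
  fix f assume "f \<in> alg_gen S"
  then show "f \<in> C" by induction (use assms in auto)
qed

lemma alg_gen_mono: "S \<subseteq> T \<Longrightarrow> alg_gen S \<subseteq> alg_gen T"
  by (rule alg_gen_minimal[OF alg_gen_subring]) (auto intro: alg_gen.intros)

lemma poly_ring_eq_alg_gen: "(poly_ring n :: 'f::field polynomial set) = alg_gen (X ` {1..n})"
proof
  show "alg_gen (X ` {1..n}) \<subseteq> poly_ring n"
    by (rule alg_gen_minimal[OF poly_ring_subring]) (auto intro: X_poly_ring)
  have "f \<in> alg_gen (X ` {1..n})" if "f \<in> poly_ring n" for f :: "'f polynomial"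
  proof -
    have "poly_subst X f \<in> alg_gen (X ` {1..n})"
      using that by (rule poly_subst_closed[OF _ alg_gen_subring]) (auto intro: alg_gen.intros)
    then show ?thesis by (simp add: poly_subst_self)
  qed
  then show "(poly_ring n :: 'f polynomial set) \<subseteq> alg_gen (X ` {1..n})" by blast
qed

text \<open>Adjoining one element to a subalgebra gives the values of the polynomials over it.
  Invariants can thus be studied by their degree in a single element.\<close>

lemma alg_gen_insert: "alg_gen (insert u S) = (\<lambda>P. poly P u) ` polys_over (alg_gen S)"
proof
  interpret B: unital_subring "alg_gen S" by (rule alg_gen_subring)
  interpret BX: unital_subring "polys_over (alg_gen S)" by (rule B.polys_over_subring)
  interpret U: unital_subring "alg_gen (insert u S)" by (rule alg_gen_subring)
  have const: "b \<in> (\<lambda>P. poly P u) ` polys_over (alg_gen S)" if "b \<in> alg_gen S" for b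
    using that by (intro image_eqI[of _ _ "[:b:]"] B.pCons_polys_over) auto
  show "alg_gen (insert u S) \<subseteq> (\<lambda>P. poly P u) ` polys_over (alg_gen S)"
  proof (rule alg_gen_minimal)
    show "unital_subring ((\<lambda>P. poly P u) ` polys_over (alg_gen S))"
    proof (unfold_locales, goal_cases)
      case 1
      show ?case using const[OF B.one] .
    next
      case (2 a b)
      then obtain P Q where "P \<in> polys_over (alg_gen S)" "Q \<in> polys_over (alg_gen S)"
        "a = poly P u" "b = poly Q u" by auto
      then show ?case by (intro image_eqI[of _ _ "P - Q"]) auto
    next
      case (3 a b)
      then obtain P Q where "P \<in> polys_over (alg_gen S)" "Q \<in> polys_over (alg_gen S)"
        "a = poly P u" "b = poly Q u" by auto
      then show ?case by (intro image_eqI[of _ _ "P * Q"]) auto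
    qed
    have "u \<in> (\<lambda>P. poly P u) ` polys_over (alg_gen S)"
      by (intro image_eqI[of _ _ "[:0, 1:]"] B.pCons_polys_over) auto
    then show "insert u S \<subseteq> (\<lambda>P. poly P u) ` polys_over (alg_gen S)"
      using const by (auto intro: alg_gen.intros)
  qed (auto intro: const alg_gen.intros)
  show "(\<lambda>P. poly P u) ` polys_over (alg_gen S) \<subseteq> alg_gen (insert u S)"
  proof safe
    fix P assume "P \<in> polys_over (alg_gen S)"
    then have "coeff P i \<in> alg_gen (insert u S)" for i
      using polys_overD alg_gen_mono[of S "insert u S"] by blast
    then show "poly P u \<in> alg_gen (insert u S)"
      unfolding poly_altdef by (intro U.sum U.mult U.power) (auto intro: alg_gen.intros)
  qed
qed

lemma poly_ring_Suc: "poly_ring (Suc n) = (\<lambda>P. poly P (X (Suc n))) ` polys_over (poly_ring n)"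
  by (simp add: poly_ring_eq_alg_gen alg_gen_insert atLeastAtMostSuc_conv)

lemma infinite_polynomials: "infinite (UNIV :: 'f::field polynomial set)"
proof -
  have "inj (\<lambda>k. Poly_Mapping.single (Poly_Mapping.single 1 k) 1 :: 'f polynomial)"
    by (rule injI) (metis lookup_single_eq lookup_single_not_eq one_neq_zero)
  then show ?thesis using finite_imageD infinite_UNIV_nat finite_subset subset_UNIV by metis
qed

text \<open>Substituting any polynomial \<open>g\<close> for \<open>X (Suc n)\<close> fixes the
  coefficients, so an equation satisfied by \<open>X (Suc n)\<close> has every \<open>g\<close>
  as a root.\<close>

lemma X_transcendental: "transcendental_over (poly_ring n) (X (Suc n) :: 'f::field polynomial)"
  unfolding transcendental_over_def
proof (intro ballI impI)
  fix P :: "'f polynomial poly"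
  assume P: "P \<in> polys_over (poly_ring n)" "poly P (X (Suc n)) = 0"
  have "poly P g = 0" for g
  proof -
    define s where "s = poly_subst (X(Suc n := g))"
    interpret s: alg_endo s unfolding s_def by (rule alg_endo_poly_subst)
    have "s (coeff P i) = coeff P i" for i
      by (rule alg_endo_eqI[OF s.alg_endo_axioms alg_endo_id polys_overD[OF P(1)]]) (auto simp: s_def)
    then have "map_poly s P = P" by (simp add: poly_eq_iff coeff_map_poly)
    moreover have "s (X (Suc n)) = g" by (simp add: s_def)
    ultimately show "poly P g = 0" using s.poly[of P "X (Suc n)"] P(2) by simp
  qed
  then have "{g. poly P g = 0} = UNIV" by auto
  then show "P = 0" using poly_roots_finite infinite_polynomials by metis
qed

section \<open>Coefficients of products\<close>

lemma lookup_single_mult_add: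
  fixes f :: "'f::field polynomial"
  shows "lookup (Poly_Mapping.single a c * f) (a + m) = c * lookup f m"
proof -
  have "Poly_Mapping.single a c * f = (\<Sum>n\<in>keys f. Poly_Mapping.single (a + n) (c * lookup f n))"
    by (subst sum_of_monomials[of f, symmetric]) (simp only: sum_distrib_left mult_single)
  then show ?thesis by (simp add: lookup_sum lookup_single when_def in_keys_iff)
qed

lemma lookup_X_mult:
  fixes f :: "'f::field polynomial"
  shows "lookup (X i * f) m = (if lookup m i = 0 then 0 else lookup f (m - Poly_Mapping.single i 1))"
proof (cases "lookup m i = 0")
  case True
  have "m \<notin> keys (X i * f)"
  proof
    assume "m \<in> keys (X i * f)"
    then obtain b where "m = Poly_Mapping.single i 1 + b" using keys_mult[of "X i" f]
      by (auto simp: X_def)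
    then show False using True by (simp add: lookup_add)
  qed
  then show ?thesis using True by (simp add: in_keys_iff)
next
  case False
  then have "m = Poly_Mapping.single i 1 + (m - Poly_Mapping.single i 1)"
    by (intro poly_mapping_eqI) (auto simp: lookup_add lookup_minus lookup_single when_def)
  then show ?thesis using False lookup_single_mult_add[of "Poly_Mapping.single i 1" 1 f "m - Poly_Mapping.single i 1"]
    by (simp add: X_def)
qed

lemma lookup_Const_mult: "lookup (Const c * f) m = c * lookup f m"
  using lookup_single_mult_add[of 0 c f m] by (simp add: Const_def)

section \<open>Permuting the variables\<close>

lemma eval_monomial_map_key:
  assumes "bij c"
  shows "eval_monomial (\<lambda>i. X (c i)) (Poly_Mapping.map_key c m) = (Poly_Mapping.single m 1 :: 'f::field polynomial)"
proof -
  have inj: "inj c" using assms by (rule bij_is_inj)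
  have "eval_monomial (\<lambda>i. X (c i)) (Poly_Mapping.map_key c m) =
      (\<Prod>i\<in>c -` keys m. X (c i) ^ lookup m (c i))"
    by (simp add: eval_monomial_def keys_map_key[OF inj] map_key.rep_eq[OF inj])
  also have "\<dots> = (\<Prod>i\<in>keys m. X i ^ lookup m i)"
    using assms by (intro prod.reindex_bij_betw)
      (auto simp: bij_betw_def inj_on_def bij_def surj_image_vimage_eq)
  also have "\<dots> = Poly_Mapping.single m 1"
    using eval_monomial_X[of m] by (simp add: eval_monomial_def)
  finally show ?thesis .
qed

text \<open>A permutation of the variables permutes the monomials, so that it only relabels the
  coefficients.\<close>

lemma lookup_permute_variables:
  fixes f :: "'f::field polynomial"
  assumes "bij c"
  shows "lookup (poly_subst (\<lambda>i. X (c i)) f) m = lookup f (Poly_Mapping.map_key c m)"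
proof -
  have inj: "inj c" and inj': "inj (inv_into UNIV c)"
    using assms by (auto simp: bij_is_inj bij_imp_bij_inv)
  have 1: "Poly_Mapping.map_key c (Poly_Mapping.map_key (inv_into UNIV c) n) = n" for n :: "nat \<Rightarrow>\<^sub>0 nat"
    using assms inj by (simp add: map_key_compose[OF inj inj'] o_def map_key_id)
  have 2: "Poly_Mapping.map_key (inv_into UNIV c) (Poly_Mapping.map_key c n) = n" for n :: "nat \<Rightarrow>\<^sub>0 nat"
    using assms by (simp add: map_key_compose[OF inj' inj] o_def map_key_id bij_is_surj surj_f_inv_f)
  have "poly_subst (\<lambda>i. X (c i)) f =
      (\<Sum>n\<in>keys f. Const (lookup f n) * eval_monomial (\<lambda>i. X (c i)) (Poly_Mapping.map_key c (Poly_Mapping.map_key (inv_into UNIV c) n)))"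
    by (simp add: 1 poly_subst_superset)
  also have "\<dots> = (\<Sum>n\<in>keys f. Poly_Mapping.single (Poly_Mapping.map_key (inv_into UNIV c) n) (lookup f n))"
    unfolding eval_monomial_map_key[OF assms] by (simp add: Const_def mult_single)
  finally have "lookup (poly_subst (\<lambda>i. X (c i)) f) m =
      (\<Sum>n\<in>keys f. lookup f n when Poly_Mapping.map_key (inv_into UNIV c) n = m)"
    by (simp add: lookup_sum lookup_single)
  also have "\<dots> = (\<Sum>n\<in>keys f. lookup f n when n = Poly_Mapping.map_key c m)"
    by (intro sum.cong when_cong) (auto simp: 1 2)
  also have "\<dots> = lookup f (Poly_Mapping.map_key c m)"
    by (auto simp: when_def in_keys_iff)
  finally show ?thesis .
qed

text \<open>The cycle \<open>1, \<dots>, p\<close>, extended by the identity to a permutation of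
  all indices.\<close>

definition cyc :: "nat \<Rightarrow> nat \<Rightarrow> nat"
  where "cyc p i = (if i \<in> {1..<p} then Suc i else if i = p then 1 else i)"

definition rotate_vars :: "nat \<Rightarrow> 'f::field polynomial \<Rightarrow> 'f polynomial"
  where "rotate_vars p = poly_subst (\<lambda>i. X (cyc p i))"

lemma cyc_funpow: "j < p \<Longrightarrow> (cyc p ^^ k) (Suc j) = Suc ((j + k) mod p)"
proof (induction k)
  case (Suc k)
  define r where "r = (j + k) mod p"
  have "r < p" using Suc by (auto simp: r_def)
  then have "cyc p (Suc r) = Suc (if Suc r = p then 0 else Suc r)" by (auto simp: cyc_def)
  moreover have "(j + Suc k) mod p = (if Suc r = p then 0 else Suc r)" by (simp add: r_def mod_Suc)
  ultimately show ?case using Suc by (simp add: r_def)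
qed auto

lemma cyc_funpow_p: "p > 0 \<Longrightarrow> cyc p ^^ p = id"
proof
  fix i assume "p > 0"
  show "(cyc p ^^ p) i = id i"
  proof (cases "i \<in> {1..p}")
    case True
    then obtain j where "i = Suc j" "j < p" by (cases i) auto
    then show ?thesis by (simp add: cyc_funpow)
  next
    case False
    then have "(cyc p ^^ k) i = i" for k by (induction k) (use \<open>p > 0\<close> in \<open>auto simp: cyc_def\<close>)
    then show ?thesis by simp
  qed
qed

lemma bij_cyc: "p > 0 \<Longrightarrow> bij (cyc p)"
proof (rule o_bij)
  assume "p > 0"
  then obtain q where "p = Suc q" by (cases p) auto
  then show "(cyc p ^^ (p - 1)) \<circ> cyc p = id" "cyc p \<circ> (cyc p ^^ (p - 1)) = id"
    using cyc_funpow_p[OF \<open>p > 0\<close>] by (simp_all add: funpow_Suc_right del: funpow.simps) (simp_all add: funpow_swap1 fun_eq_iff)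
qed

lemma cyc_in: "cyc p i \<in> {1..p} \<longleftrightarrow> i \<in> {1..p}" if "p > 0"
  using that by (auto simp: cyc_def)

definition rotate_exponents :: "nat \<Rightarrow> (nat \<Rightarrow>\<^sub>0 nat) \<Rightarrow> (nat \<Rightarrow>\<^sub>0 nat)"
  where "rotate_exponents p = Poly_Mapping.map_key (cyc p)"

lemma alg_endo_rotate_vars: "alg_endo (rotate_vars p)"
  unfolding rotate_vars_def by (rule alg_endo_poly_subst)

lemma rotate_vars_X [simp]: "rotate_vars p (X i) = X (cyc p i)"
  by (simp add: rotate_vars_def)

lemma rotate_vars_poly_ring: "p > 0 \<Longrightarrow> f \<in> poly_ring p \<Longrightarrow> rotate_vars p f \<in> poly_ring p"
  by (rule alg_endo_closed[OF alg_endo_rotate_vars, of _ p])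
    (simp, metis rotate_vars_X cyc_in X_poly_ring)

lemma lookup_rotate_exponents:
  "p > 0 \<Longrightarrow> lookup (rotate_exponents p m) i = lookup m (cyc p i)"
  unfolding rotate_exponents_def using map_key.rep_eq[OF bij_is_inj[OF bij_cyc], of p m] by simp

lemma lookup_rotate_exponents_funpow:
  "p > 0 \<Longrightarrow> lookup ((rotate_exponents p ^^ k) m) i = lookup m ((cyc p ^^ k) i)"
  by (induction k arbitrary: i) (simp_all add: lookup_rotate_exponents, simp add: funpow_swap1)

lemma rotate_exponents_funpow_p: "p > 0 \<Longrightarrow> (rotate_exponents p ^^ p) m = m"
  by (rule poly_mapping_eqI) (simp add: lookup_rotate_exponents_funpow cyc_funpow_p)

lemma lookup_rotate_vars:
  "p > 0 \<Longrightarrow> lookup (rotate_vars p f) m = lookup f (rotate_exponents p m)"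
  unfolding rotate_vars_def rotate_exponents_def by (rule lookup_permute_variables[OF bij_cyc])

lemma lookup_rotate_vars_funpow:
  "p > 0 \<Longrightarrow> lookup ((rotate_vars p ^^ k) f) m = lookup f ((rotate_exponents p ^^ k) m)"
  by (induction k arbitrary: m) (simp_all add: lookup_rotate_vars, simp add: funpow_swap1)

lemma rotate_vars_funpow_p: "p > 0 \<Longrightarrow> (rotate_vars p ^^ p) f = f"
  by (rule poly_mapping_eqI) (simp add: lookup_rotate_vars_funpow rotate_exponents_funpow_p)

lemma rotate_exponents_fixed:
  assumes "rotate_exponents p m = m" "i \<in> {1..p}"
  shows "lookup m i = lookup m 1"
proof -
  have p: "p > 0" using assms by auto
  have "(rotate_exponents p ^^ k) m = m" for k
    by (induction k) (auto simp: assms(1))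
  then have "lookup m 1 = lookup m ((cyc p ^^ (i - 1)) 1)"
    using lookup_rotate_exponents_funpow[OF p, of "i - 1" m 1] by simp
  also have "(cyc p ^^ (i - 1)) 1 = i"
    using assms(2) cyc_funpow[of 0 p "i - 1"] p by auto
  finally show ?thesis by simp
qed

text \<open>If two of the first \<open>p\<close> iterates agree, then some \<open>d\<close> with
  \<open>0 < d < p\<close> is a period of \<open>a\<close> besides \<open>p\<close>; since
  \<open>d\<close> and \<open>p\<close> are coprime, so is \<open>1\<close>.\<close>

lemma prime_period_inj_on:
  fixes f :: "'b \<Rightarrow> 'b"
  assumes "prime p" "(f ^^ p) a = a" "f a \<noteq> a"
  shows "inj_on (\<lambda>i. (f ^^ i) a) {..<p}"
proof (rule linorder_inj_onI)
  fix i j assume ij: "i < j" "i \<in> {..<p}" "j \<in> {..<p}"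
  show "(f ^^ i) a \<noteq> (f ^^ j) a"
  proof
    assume eq: "(f ^^ i) a = (f ^^ j) a"
    \<comment> \<open>Going on from \<open>j\<close> to \<open>p\<close> returns to \<open>a\<close>, and the same steps can be made from \<open>i\<close>.\<close>
    define d where "d = p - j + i"
    have d: "0 < d" "d < p" using ij by (auto simp: d_def)
    have "(f ^^ d) a = (f ^^ (p - j)) ((f ^^ j) a)"
      by (simp add: d_def funpow_add eq)
    also have "\<dots> = (f ^^ (p - j + j)) a" by (simp only: funpow_add o_apply)
    also have "\<dots> = a" using ij assms(2) by simp
    finally have da: "(f ^^ d) a = a" .
    have mult: "(f ^^ (n * e)) a = a" if "(f ^^ e) a = a" for n e
      using that by (induction n) (auto simp: funpow_add)
    have "coprime d p" using d assms(1)
      by (metis coprime_commute nat_dvd_not_less prime_imp_coprime)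
    then obtain u v where "d * u = p * v + 1"
      using coprime_bezout_strong[of d p] assms(1) by (metis not_prime_1)
    then have "(f ^^ (u * d)) a = f ((f ^^ (v * p)) a)" by (simp add: mult.commute)
    then have "a = f a" using mult[OF da] mult[OF assms(2)] by simp
    then show False using assms(3) by simp
  qed
qed linarith

lemma cyclic_sum_invariant:
  fixes s :: "'a::comm_ring_1 \<Rightarrow> 'a"
  assumes "ring_endo s" "(s ^^ p) a = a"
  shows "s (\<Sum>i<p. (s ^^ i) a) = (\<Sum>i<p. (s ^^ i) a)"
proof -
  interpret ring_endo s by fact
  have "s (\<Sum>i<p. (s ^^ i) a) = (\<Sum>i<p. (s ^^ Suc i) a)" by (simp add: sum)
  also have "\<dots> + a = (\<Sum>i<Suc p. (s ^^ i) a)"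
    by (simp add: sum.lessThan_Suc_shift del: sum.lessThan_Suc)
  finally show ?thesis using assms by simp
qed

lemma cyclic_prod_invariant:
  fixes s :: "'a::comm_ring_1 \<Rightarrow> 'a"
  assumes "ring_endo s" "(s ^^ p) a = a" "p > 0"
  shows "s (\<Prod>i<p. (s ^^ i) a) = (\<Prod>i<p. (s ^^ i) a)"
proof -
  interpret ring_endo s by fact
  obtain q where q: "p = Suc q" using assms by (cases p) auto
  have "s (\<Prod>i<p. (s ^^ i) a) = (\<Prod>i<q. (s ^^ Suc i) a) * (s ^^ p) a" by (simp add: prod mult q)
  also have "\<dots> = (\<Prod>i<p. (s ^^ i) a)"
    by (simp add: q prod.lessThan_Suc_shift assms(2)[unfolded q, simplified] del: prod.lessThan_Suc)
  finally show ?thesis .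
qed

text \<open>The monomials fixed by the rotation are the powers of the product of the variables.
  Every other monomial has an orbit of exactly \<open>p\<close> monomials, because
  \<open>p\<close> is prime, and the sum over that orbit is the transfer of any of its members.
  An invariant has constant coefficients along orbits, so the orbits can be removed one at a
  time, by induction on the number of monomials.\<close>

lemma rotation_invariant_eq_norm_plus_transfer:
  fixes g :: "'f::field polynomial"
  assumes "prime p" "g \<in> poly_ring p" "rotate_vars p g = g"
  shows "\<exists>\<alpha>\<in>alg_gen {\<Prod>i=1..p. X i}. \<exists>b\<in>poly_ring p. g = \<alpha> + (\<Sum>i<p. (rotate_vars p ^^ i) b)"
  using assms(2,3)
proof (induction "card (keys g)" arbitrary: g rule: less_induct)
  case less
  define r where "r = (rotate_vars p :: 'f polynomial \<Rightarrow> 'f polynomial)"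
  define \<rho> where "\<rho> = rotate_exponents p"
  let ?K = "alg_gen {\<Prod>i=1..p. X i :: 'f polynomial}"
  have p: "p > 0" using assms(1) prime_gt_0_nat by blast
  interpret r: alg_endo r unfolding r_def by (rule alg_endo_rotate_vars)
  interpret K: unital_subring ?K by (rule alg_gen_subring)
  interpret B: unital_subring "poly_ring p :: 'f polynomial set" by (rule poly_ring_subring)
  have lookup_r: "lookup ((r ^^ i) f) n = lookup f ((\<rho> ^^ i) n)" for i f n
    unfolding r_def \<rho>_def by (rule lookup_rotate_vars_funpow[OF p])
  have ri: "ring_endo (r ^^ i)" for i by (rule r.funpow)
  show ?case
  proof (cases "g = 0")
    case True
    have "0 = 0 + (\<Sum>i<p. (r ^^ i) 0)" using ring_endo.zero[OF ri] by simp
    then show ?thesis using True K.zero B.zero unfolding r_def by blast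
  next
    case False
    then obtain m where m: "m \<in> keys g" by (metis all_not_in_conv keys_eq_empty)
    define c where "c = lookup g m"
    define mono where "mono = (Poly_Mapping.single m c :: 'f polynomial)"
    have keys_m: "keys m \<subseteq> {1..p}" using less.prems m by (auto simp: poly_ring_def)
    then have mono: "mono \<in> poly_ring p" by (auto simp: mono_def poly_ring_def)
    \<comment> \<open>It is enough to split off a part of \<open>g\<close> that consists of some of its terms, including the one at \<open>m\<close>.\<close>
    have step: ?thesis
      if h: "h \<in> poly_ring p" "r h = h" "\<And>n. lookup h n = 0 \<or> lookup h n = lookup g n" "lookup h m = c"
        and split: "\<exists>\<alpha>\<in>?K. \<exists>b\<in>poly_ring p. h = \<alpha> + (\<Sum>i<p. (r ^^ i) b)" for h
    proof -
      have "keys (g - h) \<subseteq> keys g - {m}"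
        using h(3,4) by (auto simp: in_keys_iff lookup_minus c_def) (metis diff_0_right diff_self)
      then have "card (keys (g - h)) < card (keys g)"
        using m by (intro psubset_card_mono) auto
      moreover have "g - h \<in> poly_ring p" "rotate_vars p (g - h) = g - h"
        using less.prems h r.diff[of g h] by (auto simp: r_def)
      ultimately obtain \<alpha>' b' where 1: "\<alpha>' \<in> ?K" "b' \<in> poly_ring p"
          "g - h = \<alpha>' + (\<Sum>i<p. (r ^^ i) b')"
        using less.hyps[of "g - h"] by (auto simp: r_def)
      obtain \<alpha> b where 2: "\<alpha> \<in> ?K" "b \<in> poly_ring p" "h = \<alpha> + (\<Sum>i<p. (r ^^ i) b)"
        using split by blast
      have "g = (g - h) + h" by simp
      also have "\<dots> = (\<alpha>' + \<alpha>) + (\<Sum>i<p. (r ^^ i) (b' + b))"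
        unfolding 1(3) using 2(3) ring_endo.add[OF ri] by (simp add: sum.distrib algebra_simps)
      finally show ?thesis using 1 2 unfolding r_def by blast
    qed
    show ?thesis
    proof (cases "\<rho> m = m")
      case True
      define k where "k = lookup m 1"
      have k: "lookup m i = k" if "i \<in> {1..p}" for i
        using rotate_exponents_fixed[OF True[unfolded \<rho>_def] that] by (simp add: k_def)
      have "mono = Const c * eval_monomial X m"
        by (simp add: mono_def eval_monomial_X Const_def mult_single)
      also have "eval_monomial X m = (\<Prod>i=1..p. X i ^ lookup m i)"
        using keys_m by (intro eval_monomial_superset) auto
      also have "\<dots> = (\<Prod>i=1..p. X i ^ k)" by (intro prod.cong) (auto simp: k)
      also have "\<dots> = (\<Prod>i=1..p. X i) ^ k" by (simp add: prod_power_distrib)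
      finally have "mono \<in> ?K" by (metis alg_gen.mult alg_gen.const K.power alg_gen.incl singletonI)
      then have "\<exists>\<alpha>\<in>?K. \<exists>b\<in>poly_ring p. mono = \<alpha> + (\<Sum>i<p. (r ^^ i) b)"
        by (intro bexI[of _ mono] bexI[of _ 0]) (auto simp: ring_endo.zero[OF ri])
      moreover have "r mono = mono"
      proof (rule poly_mapping_eqI)
        fix n
        have "\<rho> n = m \<longleftrightarrow> n = m"
        proof
          assume "\<rho> n = m"
          obtain q where q: "p = Suc q" using p by (cases p) auto
          have "n = (\<rho> ^^ q) (\<rho> n)"
            using rotate_exponents_funpow_p[OF p, of n] by (simp add: \<rho>_def q funpow_swap1)
          also have "\<dots> = (\<rho> ^^ q) m" by (simp add: \<open>\<rho> n = m\<close>)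
          also have "\<dots> = m" by (induction q) (auto simp: True)
          finally show "n = m" .
        qed (use True in auto)
        then show "lookup (r mono) n = lookup mono n"
          using lookup_r[of 1 mono n] by (simp add: mono_def lookup_single when_def eq_commute)
      qed
      ultimately show ?thesis using mono
        by (intro step[of mono]) (auto simp: mono_def lookup_single when_def c_def)
    next
      case False
      define h where "h = (\<Sum>i<p. (r ^^ i) mono)"
      have rp: "(r ^^ i) f \<in> poly_ring p" if "f \<in> poly_ring p" for i f
        using that by (induction i) (auto simp: r_def rotate_vars_poly_ring[OF p])
      have lookup_h: "lookup h n = (\<Sum>i<p. c when (\<rho> ^^ i) n = m)" for n
        by (simp add: h_def lookup_sum lookup_r mono_def lookup_single eq_commute)
      have g_rho: "lookup g ((\<rho> ^^ i) n) = lookup g n" for i n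
      proof -
        have "(r ^^ i) g = g" by (induction i) (use less.prems in \<open>auto simp: r_def\<close>)
        then show ?thesis using lookup_r[of i g n] by simp
      qed
      have orbit: "lookup h n = c \<and> lookup g n = c" if "(\<rho> ^^ i) n = m" "i < p" for i n
      proof -
        have "\<rho> n \<noteq> n"
        proof
          assume "\<rho> n = n"
          then have "(\<rho> ^^ i) n = n" by (induction i) auto
          then show False using that False \<open>\<rho> n = n\<close> by simp
        qed
        then have "inj_on (\<lambda>i. (\<rho> ^^ i) n) {..<p}"
          using prime_period_inj_on[OF assms(1) rotate_exponents_funpow_p[OF p]] by (simp add: \<rho>_def)
        then have "(\<rho> ^^ j) n = m \<longleftrightarrow> j = i" if "j < p" for j
          using \<open>(\<rho> ^^ i) n = m\<close> \<open>i < p\<close> that by (auto simp: inj_on_def)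
        then have "(\<Sum>j<p. c when (\<rho> ^^ j) n = m) = (\<Sum>j<p. c when j = i)"
          by (intro sum.cong) auto
        also have "\<dots> = c" using \<open>i < p\<close> by (simp add: when_def)
        finally show ?thesis using lookup_h[of n] g_rho[of i n] that by (simp add: c_def)
      qed
      have off: "lookup h n = 0" if "\<And>i. i < p \<Longrightarrow> (\<rho> ^^ i) n \<noteq> m" for n
        unfolding lookup_h using that by (intro sum.neutral) auto
      have "lookup h n = 0 \<or> lookup h n = lookup g n" for n
        using orbit off by metis
      moreover have "lookup h m = c" using orbit[of 0 m] p by simp
      moreover have "r h = h" unfolding h_def
        using rotate_vars_funpow_p[OF p] by (intro cyclic_sum_invariant) (auto simp: r_def intro: r.ring_endo_axioms[unfolded r_def])
      moreover have "h \<in> poly_ring p" unfolding h_def using rp mono by blast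
      moreover have "\<exists>\<alpha>\<in>?K. \<exists>b\<in>poly_ring p. h = \<alpha> + (\<Sum>i<p. (r ^^ i) b)"
    proof -
      have "h = 0 + (\<Sum>i<p. (r ^^ i) mono)" by (simp add: h_def)
      then show ?thesis using mono K.zero by blast
    qed
      ultimately show ?thesis by (intro step[of h])
    qed
  qed
qed

section \<open>Coefficients at powers of the product of the variables\<close>

text \<open>The exponent vector of the \<open>n\<close>-th power of the product of the variables
  in \<open>J\<close>.\<close>

definition uniform_exponent :: "nat set \<Rightarrow> nat \<Rightarrow> (nat \<Rightarrow>\<^sub>0 nat)"
  where "uniform_exponent J n = (\<Sum>i\<in>J. Poly_Mapping.single i n)"

lemma lookup_uniform_exponent:
  "finite J \<Longrightarrow> lookup (uniform_exponent J n) i = (n when i \<in> J)"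
  by (auto simp: uniform_exponent_def lookup_sum lookup_single when_def)

text \<open>The squarefree monomial in the variables of \<open>J\<close> is obtained once for
  every ordering of \<open>J\<close>.\<close>

lemma lookup_power_sum_X:
  assumes "finite I" "J \<subseteq> I" "card J = n"
  shows "lookup ((\<Sum>i\<in>I. X i) ^ n) (uniform_exponent J 1) = (of_nat (fact n) :: 'f::field)"
  using assms(2,3)
proof (induction n arbitrary: J)
  case 0
  then have "J = {}" using assms(1) finite_subset by fastforce
  then show ?case by (simp add: uniform_exponent_def)
next
  case (Suc n)
  have J: "finite J" using Suc assms(1) finite_subset by blast
  let ?Y = "(\<Sum>i\<in>I. X i) ^ n :: 'f polynomial"
  have "lookup ((\<Sum>i\<in>I. X i) ^ Suc n) (uniform_exponent J 1) =
      (\<Sum>i\<in>I. lookup (X i * ?Y) (uniform_exponent J 1))"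
    by (simp add: sum_distrib_right lookup_sum)
  also have "\<dots> = (\<Sum>i\<in>I. if i \<in> J then of_nat (fact n) else 0)"
  proof (intro sum.cong refl)
    fix i assume "i \<in> I"
    have "uniform_exponent J 1 - Poly_Mapping.single i 1 = uniform_exponent (J - {i}) 1"
      using J by (intro poly_mapping_eqI)
        (auto simp: lookup_uniform_exponent lookup_minus lookup_single when_def)
    moreover have "lookup ?Y (uniform_exponent (J - {i}) 1) = of_nat (fact n)" if "i \<in> J"
      using that Suc.prems J by (intro Suc.IH) auto
    ultimately show "lookup (X i * ?Y) (uniform_exponent J 1) = (if i \<in> J then of_nat (fact n) else 0)"
      using J by (auto simp: lookup_X_mult lookup_uniform_exponent)
  qed
  also have "\<dots> = (\<Sum>i\<in>J. of_nat (fact n))"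
    using assms(1) Suc.prems by (simp add: sum.If_cases Int_absorb1)
  also have "\<dots> = of_nat (fact (Suc n))" using Suc.prems by (simp add: algebra_simps)
  finally show ?case .
qed

lemma alg_gen_empty: "(alg_gen {} :: 'f::field polynomial set) = range Const"
proof -
  have "f \<in> range Const" if "f \<in> alg_gen {}" for f :: "'f polynomial"
    using that by induction (auto simp flip: Const_hom)
  then show ?thesis by (auto intro: alg_gen.const)
qed

text \<open>A polynomial \<open>\<beta> - rotate_vars p \<beta>\<close> has coefficient zero at
  every monomial fixed by the rotation, in particular at the powers of the product
  \<open>M\<close> of the variables. The second factor on the left has constant term zero and
  coefficient \<open>- (p - 1)!\<close> at \<open>M\<close>, which is nonzero in characteristic
  \<open>p\<close>. Hence the lowest term \<open>a M ^ k\<close> of a nonzero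
  \<open>\<alpha>\<close> would contribute \<open>- (p - 1)! a\<close> to the coefficient of the
  product at \<open>M ^ (k + 1)\<close>, and no other term of \<open>\<alpha>\<close>
  contributes there.\<close>

lemma norm_polynomial_not_rotation_coboundary:
  fixes \<alpha> \<beta> :: "'f::field polynomial"
  assumes p: "prime p" "CHAR('f) = p" and \<alpha>: "\<alpha> \<in> alg_gen {\<Prod>i=1..p. X i}"
    and eq: "\<alpha> * (X 1 ^ p - (\<Sum>i=1..p. X i) ^ (p - 1) * X 1) = \<beta> - rotate_vars p \<beta>"
  shows "\<alpha> = 0"
proof -
  define M where "M = (\<Prod>i=1..p. X i :: 'f polynomial)"
  define e where "e = uniform_exponent {1..p}"
  \<comment> \<open>The cofactor of \<open>X 1\<close>: it shows that the second factor has constant term zero.\<close>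
  define y where "y = X 1 ^ (p - 1) - (\<Sum>i=1..p. X i :: 'f polynomial) ^ (p - 1)"
  have p2: "p \<ge> 2" using p prime_ge_2_nat by blast
  have cy: "X 1 ^ p - (\<Sum>i=1..p. X i) ^ (p - 1) * X 1 = X 1 * y"
    using p2 by (cases p) (auto simp: y_def algebra_simps)
  have lookup_e: "lookup (e n) i = (n when i \<in> {1..p})" for n i
    by (simp add: e_def lookup_uniform_exponent)
  have M: "M = Poly_Mapping.single (e 1) 1"
  proof -
    have "M = (\<Prod>i\<in>{1..p}. X i ^ lookup (e 1) i)"
      unfolding M_def by (intro prod.cong) (auto simp: lookup_e)
    also have "\<dots> = eval_monomial X (e 1)"
      by (rule eval_monomial_superset[symmetric]) (auto simp: in_keys_iff lookup_e when_def split: if_splits)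
    finally show ?thesis by (simp add: eval_monomial_X)
  qed
  have lookup_M_mult: "lookup (M * f) (e 1 + m) = lookup f m" for f m
    unfolding M lookup_single_mult_add by simp
  have ey: "lookup (X 1 * y) (e 1) \<noteq> 0"
  proof -
    have e1: "e 1 - Poly_Mapping.single 1 1 = uniform_exponent {2..p} 1"
      by (intro poly_mapping_eqI)
        (auto simp: lookup_e lookup_uniform_exponent lookup_minus lookup_single when_def)
    obtain k where k: "p - 1 = Suc k" using p2 by (cases "p - 1") auto
    have "lookup (X 1 ^ (p - 1)) (uniform_exponent {2..p} 1) = (0::'f)"
      unfolding k power_Suc by (simp add: lookup_X_mult lookup_uniform_exponent)
    moreover have "lookup ((\<Sum>i=1..p. X i) ^ (p - 1)) (uniform_exponent {2..p} 1) = (of_nat (fact (p - 1)) :: 'f)"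
      using p2 by (intro lookup_power_sum_X) auto
    ultimately have "lookup (X 1 * y) (e 1) = - (of_nat (fact (p - 1)) :: 'f)"
      using p2 e1 by (simp add: lookup_X_mult lookup_e y_def lookup_minus)
    moreover have "(of_nat (fact (p - 1)) :: 'f) \<noteq> 0"
    proof -
      have "\<not> p dvd fact (p - 1)" using p p2 by (simp add: prime_dvd_fact_iff)
      then show ?thesis using p(2) of_nat_eq_0_iff_char_dvd[of "fact (p - 1)", where 'a = 'f] by simp
    qed
    ultimately show ?thesis by simp
  qed
  have vanish: "A = 0"
    if "A \<in> polys_over (range Const)" "\<And>n. lookup (poly A M * (X 1 * y)) (e n) = 0" for A
    using that
  proof (induction A)
    case (pCons a A)
    obtain a0 where a0: "a = Const a0"
      using polys_overD[OF pCons.prems(1), of 0] by auto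
    have split: "poly (pCons a A) M * (X 1 * y) = a * (X 1 * y) + M * (poly A M * (X 1 * y))"
      by (simp add: algebra_simps)
    have "poly A M * (X 1 * y) = X 1 * (poly A M * y)" by (simp add: ac_simps)
    then have const: "lookup (poly A M * (X 1 * y)) 0 = 0"
      using lookup_X_mult[of 1 "poly A M * y" 0] by (simp only: lookup_zero refl if_True)
    have "0 = lookup (poly (pCons a A) M * (X 1 * y)) (e 1)"
      by (rule pCons.prems(2)[symmetric])
    also have "\<dots> = a0 * lookup (X 1 * y) (e 1) + lookup (M * (poly A M * (X 1 * y))) (e 1 + 0)"
      by (subst split) (simp only: lookup_add a0 lookup_Const_mult add_0_right)
    also have "\<dots> = a0 * lookup (X 1 * y) (e 1)"
      unfolding lookup_M_mult const by simp
    finally have "a = 0" using ey a0 by simp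
    have "lookup (poly A M * (X 1 * y)) (e n) = 0" for n
    proof -
      have "e (Suc n) = e 1 + e n"
        by (intro poly_mapping_eqI) (auto simp: lookup_e lookup_add when_def)
      moreover have "lookup (M * (poly A M * (X 1 * y))) (e (Suc n)) = 0"
        using pCons.prems(2)[of "Suc n"] split \<open>a = 0\<close> by (simp add: mult.assoc)
      ultimately show ?thesis
        using lookup_M_mult[of "poly A M * (X 1 * y)" "e n"] by simp
    qed
    moreover have "A \<in> polys_over (range Const)"
      using pCons.prems(1) by (force simp: polys_over_def coeff_pCons split: nat.splits)
    ultimately have "A = 0" using pCons.IH by blast
    then show ?case using \<open>a = 0\<close> by simp
  qed auto
  obtain A where A: "A \<in> polys_over (range Const)" "\<alpha> = poly A M"
    using \<alpha> by (auto simp: alg_gen_insert alg_gen_empty M_def)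
  have "lookup (poly A M * (X 1 * y)) (e n) = 0" for n
  proof -
    have "rotate_exponents p (e n) = e n"
      using p2 by (intro poly_mapping_eqI) (auto simp: lookup_rotate_exponents lookup_e cyc_def)
    then show ?thesis using eq p2 cy A
      by (simp add: lookup_minus lookup_rotate_vars)
  qed
  then show ?thesis using vanish[OF A(1)] A by simp
qed

section \<open>Powers of an endomorphism\<close>

context ring_endo begin

definition D :: "'a \<Rightarrow> 'a" where "D a = s a - a"

lemma D_funpow_zero: "(D ^^ k) 0 = 0"
  by (induction k) (auto simp: D_def)

text \<open>The binomial theorem for \<open>s = 1 + D\<close>.\<close>

lemma funpow_eq_sum_D: "(s ^^ n) a = (\<Sum>k\<le>n. of_nat (n choose k) * (D ^^ k) a)"
proof (induction n)
  case (Suc n)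
  let ?d = "\<lambda>k. (D ^^ k) a"
  have s: "s (?d k) = ?d k + ?d (Suc k)" for k by (simp add: D_def)
  have "(s ^^ Suc n) a = (\<Sum>k\<le>n. of_nat (n choose k) * ?d k) + (\<Sum>k\<le>n. of_nat (n choose k) * ?d (Suc k))"
    using Suc by (simp add: sum mult s algebra_simps sum.distrib)
  also have "(\<Sum>k\<le>n. of_nat (n choose k) * ?d k) = ?d 0 + (\<Sum>k\<le>n. of_nat (n choose Suc k) * ?d (Suc k))"
  proof -
    have "(\<Sum>k\<le>n. of_nat (n choose k) * ?d k) = (\<Sum>k\<le>Suc n. of_nat (n choose k) * ?d k)"
      by (simp add: binomial_eq_0)
    also have "\<dots> = ?d 0 + (\<Sum>k\<le>n. of_nat (n choose Suc k) * ?d (Suc k))"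
      by (simp only: sum.atMost_Suc_shift binomial_n_0 of_nat_1 mult_1)
    finally show ?thesis .
  qed
  also have "?d 0 + (\<Sum>k\<le>n. of_nat (n choose Suc k) * ?d (Suc k)) + (\<Sum>k\<le>n. of_nat (n choose k) * ?d (Suc k)) =
      ?d 0 + (\<Sum>k\<le>n. of_nat (Suc n choose Suc k) * ?d (Suc k))"
    by (simp add: algebra_simps sum.distrib)
  also have "\<dots> = (\<Sum>k\<le>Suc n. of_nat (Suc n choose k) * ?d k)"
    by (simp only: sum.atMost_Suc_shift binomial_n_0 of_nat_1 mult_1)
  finally show ?case .
qed simp

lemma funpow_prime_char:
  assumes "prime p" "CHAR('a) = p"
  shows "(s ^^ p) a = a + (D ^^ p) a"
proof -
  have p: "p > 0" using assms prime_gt_0_nat by blast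
  have "(s ^^ p) a = (\<Sum>k\<in>{0, p}. of_nat (p choose k) * (D ^^ k) a)"
    unfolding funpow_eq_sum_D
  proof (intro sum.mono_neutral_right ballI)
    fix k assume "k \<in> {..p} - {0, p}"
    then have "p dvd p choose k" using assms by (intro dvd_choose_prime) auto
    then show "of_nat (p choose k) * (D ^^ k) a = 0"
      using assms(2) of_nat_eq_0_iff_char_dvd[of "p choose k", where 'a = 'a] by simp
  qed auto
  then show ?thesis using p by simp
qed

text \<open>Summing the binomial expansions of \<open>(1 + D) ^ j\<close> over \<open>j <
  p\<close> gives \<open>p choose (k + 1)\<close> as the coefficient of \<open>D ^ k\<close>,
  and modulo \<open>p\<close> only \<open>k = p - 1\<close> survives.\<close>

lemma transfer_prime_char:
  assumes "prime p" "CHAR('a) = p"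
  shows "(\<Sum>j<p. (s ^^ j) a) = (D ^^ (p - 1)) a"
proof -
  obtain q where q: "p = Suc q" using assms prime_gt_0_nat by (cases p) auto
  have "(\<Sum>j<p. (s ^^ j) a) = (\<Sum>j\<le>q. \<Sum>k\<le>q. of_nat (j choose k) * (D ^^ k) a)"
    unfolding q lessThan_Suc_atMost funpow_eq_sum_D
    by (intro sum.cong sum.mono_neutral_left) (auto simp: binomial_eq_0)
  also have "\<dots> = (\<Sum>k\<le>q. of_nat (\<Sum>j\<le>q. j choose k) * (D ^^ k) a)"
    by (subst sum.swap) (simp add: sum_distrib_right)
  also have "\<dots> = (\<Sum>k\<le>q. of_nat (p choose Suc k) * (D ^^ k) a)"
    by (simp only: sum_choose_upper q)
  also have "\<dots> = (\<Sum>k\<in>{q}. of_nat (p choose Suc k) * (D ^^ k) a)"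
  proof (intro sum.mono_neutral_right ballI)
    fix k assume "k \<in> {..q} - {q}"
    then have "p dvd p choose Suc k" using assms q by (intro dvd_choose_prime) auto
    then show "of_nat (p choose Suc k) * (D ^^ k) a = 0"
      using assms(2) of_nat_eq_0_iff_char_dvd[of "p choose Suc k", where 'a = 'a] by simp
  qed auto
  finally show ?thesis by (simp add: q)
qed

end

text \<open>For \<open>b \<noteq> 0\<close>, both sides are polynomials in \<open>a\<close>;
  they are monic of degree \<open>p\<close>, and by Fermat's little theorem both vanish at the
  \<open>p\<close> distinct elements \<open>- k b\<close>; their difference has smaller degree
  and too many roots.\<close>

lemma prod_arithmetic_progression_prime_char:
  fixes a b :: "'a::idom"
  assumes "prime p" "CHAR('a) = p"
  shows "(\<Prod>k<p. a + of_nat k * b) = a ^ p - b ^ (p - 1) * a"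
proof (cases "b = 0")
  case True
  then show ?thesis using prime_gt_1_nat[OF assms(1)] by simp
next
  case b: False
  have p: "p > 1" using assms prime_gt_1_nat by blast
  define f where "f = monom 1 p - smult (b ^ (p - 1)) [:0, 1:]"
  define g where "g = (\<Prod>k<p. [:of_nat k * b, 1:])"
  have degf: "degree f = p" "coeff f p = 1"
  proof -
    have "degree (smult (b ^ (p - 1)) [:0, 1:]) < degree (monom (1::'a) p)"
      using p b by (simp add: degree_monom_eq)
    then show "degree f = p" unfolding f_def
      by (metis degree_add_eq_left degree_minus degree_monom_eq diff_conv_add_uminus one_neq_zero)
    show "coeff f p = 1" using p by (simp add: f_def coeff_pCons split: nat.split)
  qed
  have degg: "degree g = p" "coeff g p = 1"
  proof -
    show "degree g = p" unfolding g_def by (subst degree_prod_eq_sum_degree) auto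
    have "lead_coeff g = 1" unfolding g_def by (simp add: lead_coeff_prod)
    with \<open>degree g = p\<close> show "coeff g p = 1" by simp
  qed
  have "f - g = 0"
  proof (rule ccontr)
    assume nz: "f - g \<noteq> 0"
    have deg: "degree (f - g) < p"
    proof -
      have "degree (f - g) \<noteq> p"
        using degf degg nz leading_coeff_0_iff[of "f - g"] by force
      moreover have "degree (f - g) \<le> p" using degf degg degree_diff_le by (metis order.refl)
      ultimately show ?thesis by simp
    qed
    have root: "poly (f - g) (- (of_nat k * b)) = 0" if k: "k < p" for k
    proof -
      have "of_nat k ^ p = (of_nat k :: 'a)"
      proof -
        have "(\<Sum>i\<in>{..<k}. 1 :: 'a) ^ p = (\<Sum>i\<in>{..<k}. 1 ^ p)"
          using assms by (intro freshmans_dream_sum) auto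
        then show ?thesis by simp
      qed
      moreover have "(- (1::'a)) ^ p = - 1"
        using minus_power_prime_CHAR[of p "1 :: 'a"] assms by simp
      ultimately have "(- (of_nat k * b)) ^ p = - (of_nat k * b ^ p)"
        by (metis mult_minus1 power_mult_distrib)
      moreover have "b ^ (p - 1) * b = b ^ p" using p by (intro power_minus_mult) simp
      ultimately have "poly f (- (of_nat k * b)) = 0"
        by (simp add: f_def poly_monom algebra_simps)
      moreover have "poly g (- (of_nat k * b)) = 0"
        using k by (auto simp: g_def poly_prod)
      ultimately show ?thesis by simp
    qed
    have "inj_on (\<lambda>k. - (of_nat k * b)) {..<p}"
    proof (rule linorder_inj_onI)
      fix i j assume ij: "i < j" "i \<in> {..<p}" "j \<in> {..<p}"
      show "- (of_nat i * b) \<noteq> - (of_nat j * b)"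
      proof
        assume "- (of_nat i * b) = - (of_nat j * b)"
        then have "of_nat (j - i) = (0::'a)" using b ij by (simp add: of_nat_diff)
        then have "p dvd j - i" using assms by (simp add: of_nat_eq_0_iff_char_dvd)
        then show False using ij by (auto dest: dvd_imp_le)
      qed
    qed linarith
    then have "card ((\<lambda>k. - (of_nat k * b)) ` {..<p}) = p" by (simp add: card_image)
    moreover have "card ((\<lambda>k. - (of_nat k * b)) ` {..<p}) \<le> card {x. poly (f - g) x = 0}"
      using root by (intro card_mono poly_roots_finite nz) auto
    moreover have "card {x. poly (f - g) x = 0} \<le> degree (f - g)"
      by (rule card_poly_roots_bound[OF nz])
    ultimately show False using deg by simp
  qed
  then have "poly f a = poly g a" by simp
  then show ?thesis by (simp add: f_def g_def poly_monom poly_prod ac_simps)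
qed

section \<open>The action of a single Jordan block\<close>

text \<open>The endomorphism \<open>s\<close> plays the role of \<open>\<sigma>\<close>: on the
  variables \<open>X 1, \<dots>, X (p + 1)\<close> it is a single Jordan block, with \<open>D =
  s - 1\<close> lowering the index. \<open>B\<close> is the polynomial ring without the last
  variable \<open>t\<close>. The \<open>p\<close>-th power of \<open>s\<close> fixes
  \<open>B\<close> and translates \<open>t\<close> by \<open>X 1\<close>.\<close>

locale jordan_action = alg_endo s for s :: "'f::field polynomial \<Rightarrow> 'f polynomial" +
  fixes p :: nat
  assumes prime: "prime p" and char: "CHAR('f) = p"
    and X_1: "s (X 1) = X 1"
    and X_Suc: "i \<in> {1..p} \<Longrightarrow> s (X (Suc i)) = X (Suc i) + X i"
begin

abbreviation "B \<equiv> (poly_ring p :: 'f polynomial set)"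
abbreviation "t \<equiv> (X (Suc p) :: 'f polynomial)"

sublocale B: unital_subring B by (rule poly_ring_subring)

lemma p_gt_1: "p > 1" using prime prime_gt_1_nat by blast

lemma char_polynomial: "CHAR('f polynomial) = p" by (simp add: CHAR_polynomial char)

lemma D_X: "k < i \<Longrightarrow> i \<le> Suc p \<Longrightarrow> (D ^^ k) (X i) = X (i - k)"
proof (induction k)
  case (Suc k)
  then have "s (X (Suc (i - Suc k))) = X (Suc (i - Suc k)) + X (i - Suc k)" by (intro X_Suc) auto
  then show ?case using Suc by (simp add: D_def Suc_diff_Suc)
qed auto

lemma D_X_zero:
  assumes "i \<in> {1..Suc p}"
  shows "(D ^^ i) (X i) = 0"
proof -
  obtain j where j: "i = Suc j" using assms by (cases i) auto
  then have "(D ^^ i) (X i) = D (X 1)" using D_X[of j i] assms by simp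
  then show ?thesis using X_1 by (simp add: D_def)
qed

lemma s_X: "i \<in> {2..Suc p} \<Longrightarrow> s (X i) = X i + X (i - 1)"
proof -
  assume "i \<in> {2..Suc p}"
  then obtain j where j: "i = Suc j" "j \<in> {1..p}" by (cases i) auto
  show ?thesis using X_Suc[OF j(2)] by (simp add: j(1))
qed

lemma s_X_closed:
  assumes "i \<in> {1..n}" "n \<le> Suc p"
  shows "s (X i) \<in> poly_ring n"
proof (cases "i = 1")
  case False
  interpret n: unital_subring "poly_ring n :: 'f polynomial set" by (rule poly_ring_subring)
  have "s (X i) = X i + X (i - 1)" using False assms by (intro s_X) auto
  then show ?thesis using False assms by (auto intro!: n.add X_poly_ring)
qed (use X_1 assms in \<open>auto intro: X_poly_ring\<close>)

lemma s_closed: "f \<in> B \<Longrightarrow> s f \<in> B"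
  by (rule alg_endo_closed[OF alg_endo_axioms]) (auto intro: s_X_closed)

lemma funpow_closed: "f \<in> B \<Longrightarrow> (s ^^ k) f \<in> B"
  by (induction k) (auto intro: s_closed)

lemma funpow_p_X: "i \<in> {1..p} \<Longrightarrow> (s ^^ p) (X i) = X i"
proof -
  assume i: "i \<in> {1..p}"
  have "(D ^^ (p - i + i)) (X i) = 0" using i unfolding funpow_add by (simp add: D_X_zero D_funpow_zero)
  then show ?thesis using i funpow_prime_char[OF prime char_polynomial, of "X i"] by simp
qed

lemma funpow_p_fixes: "f \<in> B \<Longrightarrow> (s ^^ p) f = f"
  by (rule alg_endo_eqI[OF alg_endo_funpow alg_endo_id]) (auto simp: funpow_p_X)

lemma funpow_p_t: "(s ^^ p) t = t + X 1"
  using funpow_prime_char[OF prime char_polynomial, of t] D_X[of p "Suc p"] by simp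

section \<open>A permutation basis\<close>

abbreviation r :: "'f polynomial \<Rightarrow> 'f polynomial" where "r \<equiv> rotate_vars p"

sublocale r: alg_endo r by (rule alg_endo_rotate_vars)

text \<open>The variables \<open>X 1, \<dots>, X p\<close> span the regular representation of
  \<open>Z/p\<close>: the elements \<open>X p, s (X p), \<dots>, (s ^^ (p - 1)) (X p)\<close>
  form another basis, which \<open>s\<close> permutes cyclically. The coordinate change
  \<open>\<theta>\<close> and its inverse \<open>\<eta>\<close> translate between
  \<open>s\<close> and the rotation \<open>r\<close> of the variables; the values of
  \<open>\<eta>\<close> are forced by \<open>X i = (D ^^ (p - i)) (X p)\<close>.\<close>

definition \<theta> :: "'f polynomial \<Rightarrow> 'f polynomial"
  where "\<theta> = poly_subst (\<lambda>j. (s ^^ (j - 1)) (X p))"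

definition \<eta> :: "'f polynomial \<Rightarrow> 'f polynomial"
  where "\<eta> = poly_subst (\<lambda>i. (r.D ^^ (p - i)) (X 1))"

sublocale \<theta>: alg_endo \<theta> unfolding \<theta>_def by (rule alg_endo_poly_subst)
sublocale \<eta>: alg_endo \<eta> unfolding \<eta>_def by (rule alg_endo_poly_subst)

lemma \<theta>_X [simp]: "\<theta> (X j) = (s ^^ (j - 1)) (X p)" by (simp add: \<theta>_def)
lemma \<eta>_X [simp]: "\<eta> (X i) = (r.D ^^ (p - i)) (X 1)" by (simp add: \<eta>_def)

lemma r_closed: "f \<in> B \<Longrightarrow> r f \<in> B"
  by (rule rotate_vars_poly_ring) (use p_gt_1 in auto)

lemma r_D_funpow_closed: "f \<in> B \<Longrightarrow> (r.D ^^ k) f \<in> B"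
  by (induction k) (auto simp: r.D_def intro!: B.diff r_closed)

lemma \<theta>_closed: "f \<in> B \<Longrightarrow> \<theta> f \<in> B"
  by (rule alg_endo_closed[OF \<theta>.alg_endo_axioms]) 
    (use p_gt_1 in \<open>auto intro!: funpow_closed X_poly_ring\<close>)

lemma \<eta>_closed: "f \<in> B \<Longrightarrow> \<eta> f \<in> B"
  by (rule alg_endo_closed[OF \<eta>.alg_endo_axioms]) 
    (use p_gt_1 in \<open>auto intro!: r_D_funpow_closed X_poly_ring\<close>)

lemma \<theta>_r: "f \<in> B \<Longrightarrow> \<theta> (r f) = s (\<theta> f)"
proof -
  assume f: "f \<in> B"
  have "(\<theta> \<circ> r) f = (s \<circ> \<theta>) f"
  proof (rule alg_endo_eqI[OF alg_endo_comp[OF \<theta>.alg_endo_axioms r.alg_endo_axioms]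
      alg_endo_comp[OF alg_endo_axioms \<theta>.alg_endo_axioms] f])
    fix j assume j: "j \<in> {1..p}"
    show "(\<theta> \<circ> r) (X j) = (s \<circ> \<theta>) (X j)"
    proof (cases "j = p")
      case True
      have "s ((s ^^ (p - 1)) (X p)) = (s ^^ Suc (p - 1)) (X p)" by simp
      also have "\<dots> = X p" using funpow_p_X[of p] p_gt_1 by simp
      finally show ?thesis using True by (simp add: cyc_def)
    next
      case False
      then have "(s ^^ j) (X p) = s ((s ^^ (j - 1)) (X p))" using j by (cases j) auto
      then show ?thesis using False j by (simp add: cyc_def)
    qed
  qed
  then show ?thesis by simp
qed

lemma r_D_funpow_p: "(r.D ^^ p) f = 0"
  using r.funpow_prime_char[OF prime char_polynomial, of f] rotate_vars_funpow_p[of p f] p_gt_1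
  by simp

text \<open>On the variable \<open>X 1\<close>, which \<open>s\<close> fixes, this is the
  relation \<open>(r - 1) ^ p = r ^ p - 1 = 0\<close>.\<close>

lemma \<eta>_s: "f \<in> B \<Longrightarrow> \<eta> (s f) = r (\<eta> f)"
proof -
  assume f: "f \<in> B"
  have r_D: "r ((r.D ^^ k) f) = (r.D ^^ k) f + (r.D ^^ Suc k) f" for k f
    by (simp add: r.D_def)
  have "(\<eta> \<circ> s) f = (r \<circ> \<eta>) f"
  proof (rule alg_endo_eqI[OF alg_endo_comp[OF \<eta>.alg_endo_axioms alg_endo_axioms]
      alg_endo_comp[OF r.alg_endo_axioms \<eta>.alg_endo_axioms] f])
    fix i assume i: "i \<in> {1..p}"
    show "(\<eta> \<circ> s) (X i) = (r \<circ> \<eta>) (X i)"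
    proof (cases "i = 1")
      case True
      have "(r.D ^^ Suc (p - 1)) (X 1) = 0" using r_D_funpow_p[of "X 1"] p_gt_1 by simp
      with True X_1 r_D[of "p - 1" "X 1"] show ?thesis by (simp del: funpow.simps rotate_vars_X)
    next
      case False
      then have "s (X i) = X i + X (i - 1)" using i by (intro s_X) auto
      moreover have "Suc (p - i) = p - (i - 1)" using i False by auto
      ultimately show ?thesis using r_D[of "p - i" "X 1"]
        by (simp add: \<eta>.add del: funpow.simps)
    qed
  qed
  then show ?thesis by simp
qed

lemma \<eta>_funpow: "f \<in> B \<Longrightarrow> \<eta> ((s ^^ k) f) = (r ^^ k) (\<eta> f)"
  by (induction k) (auto simp: \<eta>_s funpow_closed)

lemma \<theta>_funpow: "f \<in> B \<Longrightarrow> \<theta> ((r ^^ k) f) = (s ^^ k) (\<theta> f)"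
proof (induction k)
  case (Suc k)
  have "(r ^^ k) f \<in> B" by (induction k) (auto intro: Suc r_closed)
  then show ?case using Suc by (simp add: \<theta>_r)
qed auto

lemma rotate_X_1: "j < p \<Longrightarrow> (r ^^ j) (X 1) = X (Suc j)"
  by (induction j) (auto simp: cyc_def)

lemma \<eta>_funpow_X_p: "j < p \<Longrightarrow> \<eta> ((s ^^ j) (X p)) = X (Suc j)"
  using \<eta>_funpow[OF X_poly_ring, of p j] rotate_X_1[of j] p_gt_1 by simp

lemma \<eta>_\<theta>: "f \<in> B \<Longrightarrow> \<eta> (\<theta> f) = f"
proof -
  assume f: "f \<in> B"
  have "(\<eta> \<circ> \<theta>) f = (\<lambda>f. f) f"
  proof (rule alg_endo_eqI[OF alg_endo_comp[OF \<eta>.alg_endo_axioms \<theta>.alg_endo_axioms] alg_endo_id f])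
    fix j assume "j \<in> {1..p}"
    then obtain i where "j = Suc i" "i < p" by (cases j) auto
    then show "(\<eta> \<circ> \<theta>) (X j) = X j" using \<eta>_funpow_X_p by simp
  qed
  then show ?thesis by simp
qed

lemma \<theta>_\<eta>: "f \<in> B \<Longrightarrow> \<theta> (\<eta> f) = f"
proof -
  assume f: "f \<in> B"
  have \<theta>_D: "\<theta> ((r.D ^^ k) f) = (D ^^ k) (\<theta> f)" if "f \<in> B" for k f
  proof (induction k)
    case (Suc k)
    have "\<theta> ((r.D ^^ Suc k) f) = s (\<theta> ((r.D ^^ k) f)) - \<theta> ((r.D ^^ k) f)"
      using that by (simp add: r.D_def[of "(r.D ^^ k) f"] \<theta>.diff \<theta>_r r_D_funpow_closed)
    then show ?case by (simp add: Suc D_def[of "(D ^^ k) _"])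
  qed auto
  have "(\<theta> \<circ> \<eta>) f = (\<lambda>f. f) f"
  proof (rule alg_endo_eqI[OF alg_endo_comp[OF \<theta>.alg_endo_axioms \<eta>.alg_endo_axioms] alg_endo_id f])
    fix i assume i: "i \<in> {1..p}"
    have "(\<theta> \<circ> \<eta>) (X i) = (D ^^ (p - i)) (X p)"
      using \<theta>_D[OF X_poly_ring, of 1 "p - i"] p_gt_1 by simp
    also have "\<dots> = X i" using D_X[of "p - i" p] i by simp
    finally show "(\<theta> \<circ> \<eta>) (X i) = X i" .
  qed
  then show ?thesis by simp
qed

text \<open>In characteristic \<open>p\<close>, \<open>(r - 1) ^ (p - 1)\<close> is the sum of
  the powers of \<open>r\<close>.\<close>

lemma \<eta>_X_1: "\<eta> (X 1) = (\<Sum>i=1..p. X i)"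
proof -
  have "\<eta> (X 1) = (\<Sum>j<p. (r ^^ j) (X 1))"
    using r.transfer_prime_char[OF prime char_polynomial, of "X 1"] by simp
  also have "\<dots> = (\<Sum>j<p. X (Suc j))" by (intro sum.cong rotate_X_1) auto
  also have "\<dots> = (\<Sum>i=1..p. X i)"
    by (simp add: sum.atLeast1_atMost_eq lessThan_Suc_atMost)
  finally show ?thesis .
qed

text \<open>This is the norm of \<open>X p\<close>; see \<open>prod_orbit_X_p\<close>.\<close>

definition M :: "'f polynomial" where "M = (\<Prod>i<p. (s ^^ i) (X p))"

lemma \<theta>_prod_X: "\<theta> (\<Prod>i=1..p. X i) = M"
  by (simp add: \<theta>.prod M_def prod.atLeast1_atMost_eq)

lemma prod_X_closed: "(\<Prod>i=1..p. X i) \<in> B"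
  by (auto intro!: X_poly_ring)

lemma M_closed: "M \<in> B"
  unfolding M_def using p_gt_1 by (auto intro!: funpow_closed X_poly_ring)

lemma s_M: "s M = M"
  unfolding M_def using p_gt_1 funpow_p_X[of p]
  by (intro cyclic_prod_invariant ring_endo_axioms) auto

text \<open>The decomposition of rotation invariants, transported along
  \<open>\<theta>\<close>.\<close>

lemma invariant_eq_norm_plus_transfer:
  assumes "b \<in> B" "s b = b"
  shows "\<exists>\<alpha>\<in>alg_gen {M}. \<exists>b'\<in>B. b = \<alpha> + (\<Sum>i<p. (s ^^ i) b')"
proof -
  have "r (\<eta> b) = \<eta> b" using \<eta>_s[OF assms(1)] assms(2) by simp
  then obtain \<alpha> b' where *: "\<alpha> \<in> alg_gen {\<Prod>i=1..p. X i}" "b' \<in> B"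
    "\<eta> b = \<alpha> + (\<Sum>i<p. (r ^^ i) b')"
    using rotation_invariant_eq_norm_plus_transfer[OF prime \<eta>_closed[OF assms(1)]] by blast
  have "b = \<theta> (\<eta> b)" using \<theta>_\<eta> assms by simp
  also have "\<dots> = \<theta> \<alpha> + (\<Sum>i<p. (s ^^ i) (\<theta> b'))"
    unfolding *(3) using *(2) by (simp add: \<theta>.add \<theta>.sum \<theta>_funpow)
  finally have "b = \<theta> \<alpha> + (\<Sum>i<p. (s ^^ i) (\<theta> b'))" .
  moreover have "\<theta> \<alpha> \<in> alg_gen {M}"
    using \<theta>.alg_gen_image[OF *(1)] by (simp only: image_insert image_empty \<theta>_prod_X)
  ultimately show ?thesis using \<theta>_closed[OF *(2)] by blast
qed

text \<open>The increment of \<open>N\<close> under \<open>s\<close>; see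
  \<open>s_N\<close>.\<close>

definition c :: "'f polynomial" where "c = X p ^ p - X 1 ^ (p - 1) * X p"

lemma c_closed: "c \<in> B"
  unfolding c_def by (intro B.diff B.mult B.power X_poly_ring) (use p_gt_1 in auto)

text \<open>The statement about rotations, transported along \<open>\<eta>\<close>: there
  \<open>X p\<close> becomes the first variable and \<open>X 1\<close> the sum of all of
  them.\<close>

lemma norm_polynomial_not_coboundary:
  assumes "\<alpha> \<in> alg_gen {M}" "\<beta> \<in> B" "\<alpha> * c = \<beta> - s \<beta>"
  shows "\<alpha> = 0"
proof -
  have "\<eta> M = (\<Prod>i=1..p. X i)"
    using \<eta>_\<theta>[OF prod_X_closed] by (simp only: \<theta>_prod_X)
  have "\<eta> \<alpha> \<in> alg_gen {\<eta> M}"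
    using \<eta>.alg_gen_image[OF assms(1)] by (simp only: image_insert image_empty)
  with \<open>\<eta> M = (\<Prod>i=1..p. X i)\<close> have "\<eta> \<alpha> \<in> alg_gen {\<Prod>i=1..p. X i}" by (simp only:)
  moreover have "\<eta> (X p) = X 1" by simp
  then have "\<eta> c = X 1 ^ p - (\<Sum>i=1..p. X i) ^ (p - 1) * X 1"
    unfolding c_def by (simp only: \<eta>.diff \<eta>.mult \<eta>.power \<eta>_X_1)
  then have "\<eta> \<alpha> * (X 1 ^ p - (\<Sum>i=1..p. X i) ^ (p - 1) * X 1) = \<eta> \<beta> - r (\<eta> \<beta>)"
    using arg_cong[OF assms(3), of \<eta>] assms(2) by (simp only: \<eta>.mult \<eta>.diff \<eta>_s)
  ultimately have "\<eta> \<alpha> = 0"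
    using norm_polynomial_not_rotation_coboundary[OF prime char] by blast
  moreover have "\<alpha> \<in> B"
    using assms(1) alg_gen_minimal[OF poly_ring_subring[of p], of "{M}"] M_closed by auto
  ultimately show ?thesis using \<theta>_\<eta> by (metis \<theta>.zero)
qed

section \<open>The invariants\<close>

text \<open>This is the norm of \<open>t\<close> for the subgroup generated by the
  \<open>p\<close>-th power of \<open>s\<close>; see
  \<open>prod_orbit_t_subgroup\<close>.\<close>

definition N :: "'f polynomial" where "N = t ^ p - X 1 ^ (p - 1) * t"

definition N_poly :: "'f polynomial poly" where "N_poly = monom 1 p - [:0, X 1 ^ (p - 1):]"

lemma N_poly: "N_poly \<in> polys_over B" "degree N_poly = p" "lead_coeff N_poly = 1" "poly N_poly t = N"
proof -
  define a :: "'f polynomial" where "a = X 1 ^ (p - 1)"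
  have a: "a \<in> B" unfolding a_def using p_gt_1 by (intro B.power X_poly_ring) auto
  have N_poly_a: "N_poly = monom 1 p + [:0, - a:]" by (simp add: N_poly_def a_def)
  have coeff: "coeff N_poly i = (if i = p then 1 else 0) + (if i = 1 then - a else 0)" for i
    unfolding N_poly_a coeff_add coeff_monom by (auto simp: coeff_pCons split: nat.split)
  have "coeff N_poly i \<in> B" for i
    unfolding coeff using a B.uminus[OF a] B.zero B.one by (intro B.add) presburger+
  then show "N_poly \<in> polys_over B" by (simp add: polys_over_def)
  have "degree [:0, - a:] < degree (monom (1::'f polynomial) p)"
    using p_gt_1 by (simp add: degree_monom_eq)
  then show deg: "degree N_poly = p" unfolding N_poly_a
    by (subst degree_add_eq_left) (auto simp: degree_monom_eq)
  show "lead_coeff N_poly = 1" unfolding deg coeff using p_gt_1 by simp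
  show "poly N_poly t = N" unfolding N_poly_a by (simp add: N_def poly_monom a_def algebra_simps)
qed

lemma s_N: "s N = N + c"
proof -
  have "(t + X p) ^ p = t ^ p + X p ^ p"
    using prime char_polynomial by (intro freshmans_dream) auto
  moreover have "s t = t + X p" using X_Suc[of p] p_gt_1 by simp
  ultimately show ?thesis by (simp add: N_def c_def diff mult power X_1[simplified] algebra_simps)
qed

lemma funpow_p_N: "(s ^^ p) N = N"
proof -
  interpret sp: alg_endo "s ^^ p" by (rule alg_endo_funpow)
  have "(t + X 1) ^ p = t ^ p + X 1 ^ p"
    using prime char_polynomial by (intro freshmans_dream) auto
  moreover have "X 1 ^ (p - 1) * X 1 = (X 1 ^ p :: 'f polynomial)"
    using p_gt_1 by (intro power_minus_mult) simp
  moreover have "(s ^^ p) (X 1) = X 1" using funpow_p_X p_gt_1 by simp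
  ultimately show ?thesis by (simp add: N_def sp.diff sp.mult sp.power funpow_p_t algebra_simps)
qed

definition BN :: "'f polynomial set" where "BN = alg_gen (insert N (X ` {1..p}))"

lemma BN_eq: "BN = (\<lambda>P. poly P N) ` polys_over B"
  by (simp add: BN_def alg_gen_insert poly_ring_eq_alg_gen)

sublocale BN: unital_subring BN unfolding BN_def by (rule alg_gen_subring)

lemma B_subset_BN: "B \<subseteq> BN"
  unfolding BN_def poly_ring_eq_alg_gen by (rule alg_gen_mono) auto

lemma N_in_BN: "N \<in> BN" unfolding BN_def by (auto intro: alg_gen.incl)

lemma BN_subset: "BN \<subseteq> poly_ring (Suc p)"
proof -
  interpret A: unital_subring "poly_ring (Suc p) :: 'f polynomial set" by (rule poly_ring_subring)
  show ?thesis unfolding BN_def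
    by (rule alg_gen_minimal[OF poly_ring_subring])
      (use p_gt_1 in \<open>auto simp: N_def intro!: X_poly_ring A.diff A.mult A.power\<close>)
qed

lemma funpow_p_BN: "f \<in> BN \<Longrightarrow> (s ^^ p) f = f"
proof -
  interpret sp: alg_endo "s ^^ p" by (rule alg_endo_funpow)
  show "f \<in> BN \<Longrightarrow> (s ^^ p) f = f" unfolding BN_def
    by (induction rule: alg_gen.induct) (auto simp: funpow_p_N funpow_p_X sp.add sp.mult simp del: One_nat_def)
qed

lemma X_nonzero: "X i \<noteq> (0 :: 'f polynomial)"
  unfolding X_def by (metis lookup_single_eq lookup_zero one_neq_zero)

text \<open>The invariants of the subgroup of order \<open>p\<close>, by leading coefficients
  with respect to \<open>t\<close>: all of \<open>B\<close> is fixed, so any coefficient may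
  serve as \<open>\<alpha>\<close> and every \<open>\<beta> - (s ^^ p) \<beta>\<close> is zero,
  while the increment \<open>X 1\<close> of \<open>t\<close> is not.\<close>

lemma funpow_p_invariants:
  assumes "f \<in> poly_ring (Suc p)" "(s ^^ p) f = f"
  shows "f \<in> BN"
proof -
  obtain P where P: "P \<in> polys_over B" "f = poly P t" using assms(1) by (auto simp: poly_ring_Suc)
  show ?thesis unfolding P(2)
  proof (rule invariant_by_leading_coefficients[where s = "s ^^ p" and B = B and K = B and c = "X 1" and q = N_poly and p = p])
    show "\<exists>\<alpha>\<in>B. \<exists>R\<in>polys_over B. degree R \<le> d \<and> coeff R d = b - \<alpha> \<and>
        (s ^^ p) (poly R t) = poly R t \<and> poly R t \<in> BN" if "b \<in> B" for b d
      using that by (intro bexI[of _ b] bexI[of _ 0]) (auto simp: ring_endo.zero[OF funpow])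
    show "\<alpha> = 0" if "\<alpha> \<in> B" "\<beta> \<in> B" "\<alpha> * X 1 = \<beta> - (s ^^ p) \<beta>" for \<alpha> \<beta>
      using that X_nonzero[of 1] by (simp add: funpow_p_fixes)
    show "X 1 \<in> B" using p_gt_1 by (intro X_poly_ring) auto
    show "(s ^^ p) (poly N_poly t) = poly N_poly t" "poly N_poly t \<in> BN"
      unfolding N_poly(4) by (rule funpow_p_N, rule N_in_BN)
    show "of_nat n * \<alpha> \<in> B" if "\<alpha> \<in> B" for n \<alpha> using that by (intro B.mult B.of_nat)
    show "B \<subseteq> B \<inter> BN" using B_subset_BN by blast
    show "(s ^^ p) (poly P t) = poly P t" using assms(2) P(2) by simp
    show "p > 0" using p_gt_1 by simp
  qed (fact funpow poly_ring_subring funpow_closed X_transcendental funpow_p_t char_polynomial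
      N_poly funpow_p_fixes P(1) BN.zero BN.add BN.mult)+
qed

text \<open>This is the norm of \<open>t\<close> for the whole group; see
  \<open>prod_orbit_t\<close>. As a polynomial in \<open>N\<close> it is monic of degree
  \<open>p\<close>.\<close>

definition Q :: "'f polynomial" where "Q = (\<Prod>i<p. (s ^^ i) N)"
definition Tr :: "'f polynomial \<Rightarrow> 'f polynomial" where "Tr f = (\<Sum>i<p. (s ^^ i) f)"

lemma funpow_N: "\<exists>b\<in>B. (s ^^ i) N = N + b"
proof (induction i)
  case (Suc i)
  then obtain b where "b \<in> B" "(s ^^ i) N = N + b" by blast
  then show ?case
    by (intro bexI[of _ "c + s b"]) (auto simp: add s_N c_closed s_closed)
qed (auto intro: bexI[of _ 0])

lemma s_Q: "s Q = Q"
  unfolding Q_def using p_gt_1 funpow_p_N by (intro cyclic_prod_invariant ring_endo_axioms) auto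

lemma s_Tr: "f \<in> BN \<Longrightarrow> s (Tr f) = Tr f"
  unfolding Tr_def by (intro cyclic_sum_invariant ring_endo_axioms funpow_p_BN)

text \<open>The leading coefficients are now taken with respect to \<open>N\<close>. Modulo
  polynomials in \<open>M\<close>, the leading coefficient of an invariant is a transfer
  \<open>Tr a'\<close>, and this is the leading coefficient of \<open>Tr (a' * N ^ d)\<close>,
  because each \<open>(s ^^ i) N\<close> differs from \<open>N\<close> by an element of
  \<open>B\<close>.\<close>

lemma invariants_eq:
  "{f \<in> poly_ring (Suc p). s f = f} = alg_gen ({M, Q} \<union> Tr ` BN)"
proof
  let ?S = "alg_gen ({M, Q} \<union> Tr ` BN)"
  interpret A: unital_subring "poly_ring (Suc p) :: 'f polynomial set" by (rule poly_ring_subring)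
  interpret S: unital_subring ?S by (rule alg_gen_subring)
  interpret BX: unital_subring "polys_over B" by (rule B.polys_over_subring)
  have sA: "s f \<in> poly_ring (Suc p)" if "f \<in> poly_ring (Suc p)" for f
    by (rule alg_endo_closed[OF alg_endo_axioms that]) (rule s_X_closed, auto)
  have sA': "(s ^^ k) f \<in> poly_ring (Suc p)" if "f \<in> poly_ring (Suc p)" for f k
    by (induction k) (auto simp: that sA)
  show "?S \<subseteq> {f \<in> poly_ring (Suc p). s f = f}"
  proof (rule alg_gen_minimal)
    show "unital_subring {f \<in> poly_ring (Suc p). s f = f}"
      by unfold_locales (auto simp: diff mult)
    have "Q \<in> poly_ring (Suc p)" "Tr f \<in> poly_ring (Suc p)" if "f \<in> BN" for f
      unfolding Q_def Tr_def using BN_subset N_in_BN that by (auto intro!: sA')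
    then show "{M, Q} \<union> Tr ` BN \<subseteq> {f \<in> poly_ring (Suc p). s f = f}"
      using M_closed poly_ring_mono[of p "Suc p"] N_in_BN by (auto simp: s_M s_Q s_Tr)
  qed auto
  have K: "alg_gen {M} \<subseteq> B \<inter> ?S \<inter> {f. s f = f}"
  proof -
    have "unital_subring {f. s f = f}" by unfold_locales (auto simp: diff mult)
    then have "alg_gen {M} \<subseteq> {f. s f = f}" by (rule alg_gen_minimal) (auto simp: s_M)
    then show ?thesis
      using alg_gen_minimal[OF poly_ring_subring[of p], of "{M}"] alg_gen_mono[of "{M}" "{M, Q} \<union> Tr ` BN"]
        M_closed by auto
  qed
  obtain b where b: "\<And>i. b i \<in> B" "\<And>i. (s ^^ i) N = N + b i" using funpow_N by metis
  define q where "q = (\<Prod>i<p. [:b i, 1:])"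
  have linear: "[:b i, 1:] \<in> polys_over B" for i
    using b by (intro B.pCons_polys_over) auto
  have q: "q \<in> polys_over B" "degree q = p" "lead_coeff q = 1" "poly q N = Q"
  proof -
    show "q \<in> polys_over B" unfolding q_def using linear by (intro BX.prod)
    show "degree q = p" unfolding q_def by (subst degree_prod_eq_sum_degree) auto
    show "lead_coeff q = 1" unfolding q_def lead_coeff_prod by simp
    show "poly q N = Q" by (simp add: q_def Q_def poly_prod b add.commute)
  qed
  have N_trans: "transcendental_over B N"
    using transcendental_over_poly[OF X_transcendental poly_ring_subring N_poly(1)] N_poly(2,4) p_gt_1 by simp
  show "{f \<in> poly_ring (Suc p). s f = f} \<subseteq> ?S"
  proof safe
    fix f assume f: "f \<in> poly_ring (Suc p)" "s f = f"
    have "(s ^^ k) f = f" for k by (induction k) (auto simp: f)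
    then have "f \<in> BN" using funpow_p_invariants f by blast
    then obtain P where P: "P \<in> polys_over B" "f = poly P N" by (auto simp: BN_eq)
    show "f \<in> ?S" unfolding P(2)
    proof (rule invariant_by_leading_coefficients[where s = s and B = B and K = "alg_gen {M}" and c = c and q = q and p = p])
      show "\<exists>\<alpha>\<in>alg_gen {M}. \<exists>R\<in>polys_over B. degree R \<le> d \<and> coeff R d = a - \<alpha> \<and>
          s (poly R N) = poly R N \<and> poly R N \<in> ?S" if a: "a \<in> B" "s a = a" for a d
      proof -
        obtain \<alpha> a' where \<alpha>: "\<alpha> \<in> alg_gen {M}" "a' \<in> B" "a = \<alpha> + (\<Sum>i<p. (s ^^ i) a')"
          using invariant_eq_norm_plus_transfer[OF a] by blast
        define R where "R = (\<Sum>i<p. smult ((s ^^ i) a') ([:b i, 1:] ^ d))"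
        have deg: "degree ([:b i, 1:] ^ d) = d" for i by (simp add: degree_power_eq)
        have "degree R \<le> d" unfolding R_def
        proof (rule degree_sum_le)
          show "degree (smult ((s ^^ i) a') ([:b i, 1:] ^ d)) \<le> d" for i
            using degree_smult_le[of "(s ^^ i) a'" "[:b i, 1:] ^ d"] unfolding deg .
        qed auto
        moreover have "coeff R d = a - \<alpha>"
        proof -
          have "coeff ([:b i, 1:] ^ d) d = 1" for i
            using lead_coeff_power[of "[:b i, 1:]" d] unfolding deg by simp
          then show ?thesis by (simp add: R_def coeff_sum \<alpha>(3))
        qed
        moreover have "R \<in> polys_over B"
          unfolding R_def using linear \<alpha> by (auto intro!: BX.sum B.smult_polys_over BX.power funpow_closed)
        moreover have aN: "a' * N ^ d \<in> BN" using \<alpha> B_subset_BN N_in_BN by blast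
        have "poly R N = Tr (a' * N ^ d)"
          unfolding R_def Tr_def
        proof (subst poly_sum, intro sum.cong refl)
          fix i
          interpret si: ring_endo "s ^^ i" by (rule funpow)
          show "poly (smult ((s ^^ i) a') ([:b i, 1:] ^ d)) N = (s ^^ i) (a' * N ^ d)"
            by (simp add: si.mult si.power b add.commute)
        qed
        ultimately show ?thesis using \<alpha>(1) aN s_Tr[OF aN]
          by (intro bexI[of _ \<alpha>] bexI[of _ R]) (auto intro: alg_gen.incl)
      qed
      show "of_nat n * \<alpha> \<in> alg_gen {M}" if "\<alpha> \<in> alg_gen {M}" for n \<alpha>
        using that unital_subring.mult[OF alg_gen_subring unital_subring.of_nat[OF alg_gen_subring]] by blast
      show "\<alpha> = 0" if "\<alpha> \<in> alg_gen {M}" "\<beta> \<in> B" "\<alpha> * c = \<beta> - s \<beta>" for \<alpha> \<beta>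
        using norm_polynomial_not_coboundary that by blast
      show "s (poly q N) = poly q N" unfolding q(4) by (rule s_Q)
      show "poly q N \<in> ?S" unfolding q(4) by (rule alg_gen.incl) simp
      show "alg_gen {M} \<subseteq> B \<inter> ?S" using K by blast
      show "s \<alpha> = \<alpha>" if "\<alpha> \<in> alg_gen {M}" for \<alpha> using that K by blast
      show "s (poly P N) = poly P N" using f(2) P(2) by simp
      show "p > 0" using p_gt_1 by simp
    qed (fact ring_endo_axioms poly_ring_subring s_closed N_trans s_N c_closed char_polynomial
        q P(1) S.zero S.add S.mult)+
  qed
qed

end

context jordan_action begin

section \<open>The norms as products over orbits\<close>

lemma funpow_p_mult_t: "(s ^^ (p * k)) t = t + of_nat k * X 1"
proof (induction k)
  case (Suc k)
  interpret sp: alg_endo "s ^^ p" by (rule alg_endo_funpow)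
  have "(s ^^ (p * Suc k)) t = (s ^^ p) ((s ^^ (p * k)) t)" by (simp add: funpow_add)
  also have "\<dots> = t + X 1 + of_nat k * X 1"
    using funpow_p_X[of 1] p_gt_1 Suc by (simp add: sp.add sp.mult funpow_p_t)
  finally show ?case by (simp add: algebra_simps)
qed simp

lemma of_nat_inj_below_p:
  assumes "i < p" "j < p" "of_nat i = (of_nat j :: 'f polynomial)"
  shows "i = j"
proof -
  have False if "k < l" "l < p" "of_nat k = (of_nat l :: 'f polynomial)" for k l
  proof -
    have "of_nat (l - k) = (0 :: 'f polynomial)" using that by (simp add: of_nat_diff)
    then have "p dvd l - k" by (simp add: of_nat_eq_0_iff_char_dvd char_polynomial)
    then show False using that by (auto dest: dvd_imp_le)
  qed
  then show ?thesis using assms by (metis linorder_neqE_nat)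
qed

lemma of_nat_mod: "of_nat (k mod p) = (of_nat k :: 'f polynomial)"
proof -
  have "(of_nat k :: 'f polynomial) = of_nat (k mod p + p * (k div p))" by (simp only: mod_mult_div_eq)
  also have "\<dots> = of_nat (k mod p) + of_nat p * of_nat (k div p)" by (simp only: of_nat_add of_nat_mult)
  also have "of_nat p = (0 :: 'f polynomial)" by (simp add: of_nat_eq_0_iff_char_dvd char_polynomial)
  finally show ?thesis by simp
qed

lemma prod_orbit_t_subgroup: "\<Prod> (range (\<lambda>k. (s ^^ (p * k)) t)) = N"
proof -
  let ?f = "\<lambda>k. t + of_nat k * X 1"
  have p0: "p > 0" using p_gt_1 by simp
  have "range (\<lambda>k. (s ^^ (p * k)) t) = ?f ` {..<p}"
  proof (intro equalityI subsetI; elim imageE)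
    fix f and k :: nat assume "f = (s ^^ (p * k)) t"
    then have "f = ?f (k mod p)" by (simp add: funpow_p_mult_t of_nat_mod)
    then show "f \<in> ?f ` {..<p}" using p0 by auto
  next
    fix f and k :: nat assume "f = ?f k"
    then show "f \<in> range (\<lambda>k. (s ^^ (p * k)) t)" using funpow_p_mult_t[of k] by (metis rangeI)
  qed
  moreover have "inj_on ?f {..<p}"
    using X_nonzero[of 1] by (auto simp: inj_on_def intro: of_nat_inj_below_p)
  ultimately have "\<Prod> (range (\<lambda>k. (s ^^ (p * k)) t)) = (\<Prod>k<p. ?f k)"
    by (simp add: prod.reindex)
  also have "\<dots> = N"
    unfolding N_def by (rule prod_arithmetic_progression_prime_char[OF prime char_polynomial])
  finally show ?thesis .
qed

lemma X_eq_iff: "X i = (X j :: 'f polynomial) \<longleftrightarrow> i = j"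
proof
  assume "X i = (X j :: 'f polynomial)"
  then have "Poly_Mapping.single i (1::nat) = Poly_Mapping.single j 1"
    unfolding X_def by (metis lookup_single_eq lookup_single_not_eq one_neq_zero)
  then show "i = j" by (metis lookup_single_eq lookup_single_not_eq one_neq_zero)
qed simp

lemma prod_orbit_X_p: "\<Prod> (range (\<lambda>i. (s ^^ i) (X p))) = M"
proof -
  have per: "(s ^^ i) (X p) = (s ^^ (i mod p)) (X p)" for i
  proof -
    have "(s ^^ (p * k)) (X p) = X p" for k
      using funpow_p_X[of p] p_gt_1 by (induction k) (auto simp: funpow_add)
    then have "(s ^^ (i mod p + p * (i div p))) (X p) = (s ^^ (i mod p)) (X p)"
      by (simp only: funpow_add o_apply)
    then show ?thesis by (simp only: mod_mult_div_eq)
  qed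
  have "range (\<lambda>i. (s ^^ i) (X p)) = (\<lambda>i. (s ^^ i) (X p)) ` {..<p}"
  proof (intro equalityI subsetI; elim imageE)
    fix f i assume "f = (s ^^ i) (X p)"
    then have "f = (s ^^ (i mod p)) (X p)" using per by simp
    then show "f \<in> (\<lambda>i. (s ^^ i) (X p)) ` {..<p}" by (rule image_eqI) (use p_gt_1 in auto)
  qed auto
  moreover have "inj_on (\<lambda>i. (s ^^ i) (X p)) {..<p}"
  proof (rule inj_onI)
    fix i j assume "i \<in> {..<p}" "j \<in> {..<p}" "(s ^^ i) (X p) = (s ^^ j) (X p)"
    then have "X (Suc i) = (X (Suc j) :: 'f polynomial)" by (metis \<eta>_funpow_X_p lessThan_iff)
    then show "i = j" by (simp add: X_eq_iff)
  qed
  ultimately show ?thesis by (simp add: prod.reindex M_def)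
qed

lemma funpow_t: "(s ^^ i) t = t + (\<Sum>j<i. (s ^^ j) (X p))"
proof (induction i)
  case (Suc i)
  have "(s ^^ Suc i) t = (s ^^ i) (s t)" by (simp add: funpow_swap1)
  also have "s t = t + X p" using X_Suc[of p] p_gt_1 by simp
  also have "(s ^^ i) \<dots> = (s ^^ i) t + (s ^^ i) (X p)" by (rule ring_endo.add[OF funpow])
  finally show ?case using Suc by (simp add: algebra_simps)
qed simp

lemma lookup_X_single: "lookup (X i :: 'f polynomial) (Poly_Mapping.single j 1) = (1 when i = j)"
proof -
  have "Poly_Mapping.single i (1::nat) = Poly_Mapping.single j 1 \<longleftrightarrow> i = j"
    by (metis lookup_single_eq lookup_single_not_eq one_neq_zero)
  then show ?thesis by (simp add: X_def lookup_single when_def)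
qed

text \<open>In the coordinates given by \<open>\<eta>\<close>, the two sides differ from
  \<open>t\<close> by sums \<open>X 1 + \<dots> + X i + k (X 1 + \<dots> + X p)\<close>. As
  \<open>i < p\<close>, the coefficient of \<open>X p\<close> is \<open>k\<close>; after that,
  the other coefficients determine \<open>i\<close>.\<close>

lemma orbit_t_injective:
  assumes "i < p" "j < p" "k < p" "l < p"
    and eq: "(s ^^ i) t + of_nat k * X 1 = (s ^^ j) t + of_nat l * X 1"
  shows "i = j \<and> k = l"
proof -
  have img: "\<eta> ((\<Sum>j<i. (s ^^ j) (X p)) + of_nat k * X 1) =
      (\<Sum>j<i. X (Suc j)) + of_nat k * (\<Sum>i=1..p. X i)" if "i < p" for i k
  proof -
    have "(\<Sum>j<i. \<eta> ((s ^^ j) (X p))) = (\<Sum>j<i. X (Suc j))"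
      using that by (intro sum.cong \<eta>_funpow_X_p) auto
    then show ?thesis by (simp only: \<eta>.add \<eta>.sum \<eta>.mult \<eta>.of_nat \<eta>_X_1)
  qed
  have "(\<Sum>j<i. (s ^^ j) (X p)) + of_nat k * X 1 = (\<Sum>i<j. (s ^^ i) (X p)) + of_nat l * X 1"
    using eq unfolding funpow_t by (simp add: add.assoc)
  from arg_cong[OF this, of \<eta>] have sums:
    "(\<Sum>j<i. X (Suc j)) + of_nat k * (\<Sum>i=1..p. X i) = (\<Sum>i<j. X (Suc i)) + of_nat l * (\<Sum>i=1..p. (X i :: 'f polynomial))"
    using assms by (simp only: img)
  have lookup_sums: "lookup ((\<Sum>j<i. X (Suc j)) + of_nat k * (\<Sum>i=1..p. (X i :: 'f polynomial))) (Poly_Mapping.single (Suc m) 1)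
      = (1 when m < i) + of_nat k" if "m < p" for i k m
  proof -
    have "(\<Sum>j<i. (1::'f) when j = m) = (1 when m < i)" by (simp add: when_def)
    moreover have "(\<Sum>i=1..p. (1::'f) when i = Suc m) = 1"
      using that by (simp add: when_def)
    ultimately show ?thesis
      unfolding of_nat_eq_Const by (simp add: lookup_add lookup_Const_mult lookup_sum lookup_X_single[simplified])
  qed
  have "(of_nat k :: 'f) = of_nat l"
    using arg_cong[OF sums, of "\<lambda>f. lookup f (Poly_Mapping.single (Suc (p - 1)) 1)"] p_gt_1 assms
    unfolding lookup_sums[of "p - 1", OF diff_less[OF zero_less_one order.strict_trans[OF zero_less_one p_gt_1]]]
    by simp
  then have "of_nat k = (of_nat l :: 'f polynomial)" by (simp add: of_nat_eq_Const)
  then have kl: "k = l" using assms of_nat_inj_below_p by blast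
  have "(m < i) = (m < j)" if "m < p" for m
  proof -
    have "((1::'f) when m < i) = (1 when m < j)"
      using arg_cong[OF sums, of "\<lambda>f. lookup f (Poly_Mapping.single (Suc m) 1)"] kl
      unfolding lookup_sums[OF that] by simp
    then show ?thesis by (auto simp: when_def split: if_splits)
  qed
  then have "i = j" using assms by (metis linorder_neqE_nat less_irrefl)
  with kl show ?thesis by simp
qed

text \<open>Writing the exponents as \<open>i + p * k\<close> arranges the orbit of
  \<open>t\<close> into the images of its orbit under the subgroup of order \<open>p\<close>,
  whose product is \<open>N\<close>.\<close>

lemma prod_orbit_t: "\<Prod> (range (\<lambda>i. (s ^^ i) t)) = Q"
proof -
  let ?f = "\<lambda>(i, k). (s ^^ i) t + of_nat k * X 1"
  have p0: "p > 0" using p_gt_1 by simp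
  have fix1: "(s ^^ i) (X 1) = X 1" for i by (induction i) (simp_all only: funpow.simps id_apply o_apply X_1)
  have shift: "(s ^^ i) (t + of_nat k * X 1) = (s ^^ i) t + of_nat k * X 1" for i k
  proof -
    interpret si: ring_endo "s ^^ i" by (rule funpow)
    show ?thesis by (simp only: si.add si.mult si.of_nat fix1)
  qed
  have power: "(s ^^ (i + p * k)) t = (s ^^ i) t + of_nat k * X 1" for i k
    by (simp only: funpow_add o_apply funpow_p_mult_t shift)
  have "range (\<lambda>i. (s ^^ i) t) = ?f ` ({..<p} \<times> {..<p})"
  proof (intro equalityI subsetI; elim imageE)
    fix f n assume "f = (s ^^ n) t"
    then have "f = (s ^^ (n mod p)) t + of_nat (n div p) * X 1"
      using power[of "n mod p" "n div p"] by (simp only: mod_mult_div_eq)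
    then have "f = ?f (n mod p, (n div p) mod p)" by (simp add: of_nat_mod)
    then show "f \<in> ?f ` ({..<p} \<times> {..<p})"
      by (rule image_eqI) (use p0 in auto)
  next
    fix f ik assume f: "f = ?f ik"
    have "f = (s ^^ (fst ik + p * snd ik)) t"
      using f unfolding power case_prod_beta .
    then show "f \<in> range (\<lambda>i. (s ^^ i) t)" by (rule range_eqI)
  qed
  moreover have "inj_on ?f ({..<p} \<times> {..<p})"
  proof (rule inj_onI)
    fix a b assume ab: "a \<in> {..<p} \<times> {..<p}" "b \<in> {..<p} \<times> {..<p}" "?f a = ?f b"
    then have "fst a = fst b \<and> snd a = snd b"
      unfolding case_prod_beta by (intro orbit_t_injective) auto
    then show "a = b" by (simp add: prod_eq_iff)
  qed
  ultimately have "\<Prod> (range (\<lambda>i. (s ^^ i) t)) = (\<Prod>ik\<in>{..<p} \<times> {..<p}. ?f ik)"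
    by (simp add: prod.reindex)
  also have "\<dots> = (\<Prod>i<p. \<Prod>k<p. (s ^^ i) (t + of_nat k * X 1))"
    by (simp only: prod.cartesian_product shift)
  also have "\<dots> = (\<Prod>i<p. (s ^^ i) (\<Prod>k<p. t + of_nat k * X 1))"
    by (simp only: ring_endo.prod[OF funpow])
  also have "\<dots> = Q"
    unfolding Q_def N_def prod_arithmetic_progression_prime_char[OF prime char_polynomial] ..
  finally show ?thesis .
qed

end

section \<open>Cyclic groups of order the square of a prime\<close>

lemma cyclic_group_carrier:
  fixes G (structure)
  assumes "group G" "G \<cong> integer_mod_group n" "n > 0" "\<sigma> \<in> carrier G" "generate G {\<sigma>} = carrier G"
  shows "finite (carrier G)" "Coset.order G = n" "group.ord G \<sigma> = n"
    "carrier G = range (\<lambda>i::nat. \<sigma> [^] i)"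
proof -
  interpret group G by fact
  obtain h where "bij_betw h (carrier G) (carrier (integer_mod_group n))"
    using assms(2) by (auto simp: is_iso_def iso_def)
  then have card: "card (carrier G) = card {0..<int n}" and fin: "finite (carrier G)"
    using assms(3) bij_betw_same_card bij_betw_finite by (fastforce simp: carrier_integer_mod_group)+
  show "finite (carrier G)" by fact
  show "Coset.order G = n" using card by (simp add: Coset.order_def)
  then show "ord \<sigma> = n" using generate_pow_card[OF assms(4)] assms(5) by (simp add: Coset.order_def)
  show "carrier G = range (\<lambda>i::nat. \<sigma> [^] i)"
    using generate_pow_on_finite_carrier[OF fin assms(4)] assms(5) by auto
qed

text \<open>By Lagrange's theorem \<open>L\<close> has \<open>p\<close> elements, which are
  therefore annihilated by \<open>p\<close>. In terms of the generator this means that they are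
  \<open>p\<close>-th powers, of which there are at most \<open>p\<close>.\<close>

lemma proper_subgroup_cyclic_group_prime_square:
  fixes G (structure) and p :: nat
  assumes "group G" "G \<cong> integer_mod_group (p ^ 2)" "prime p"
    "\<sigma> \<in> carrier G" "generate G {\<sigma>} = carrier G"
    "subgroup L G" "L \<noteq> {\<one>}" "L \<noteq> carrier G"
  shows "L = range (\<lambda>k::nat. \<sigma> [^] (p * k))"
proof -
  interpret group G by fact
  have p0: "p > 0" using assms(3) prime_gt_0_nat by blast
  note G = cyclic_group_carrier[OF assms(1,2) _ assms(4,5)]
  have fin: "finite (carrier G)" and ord: "Coset.order G = p ^ 2" "ord \<sigma> = p ^ 2"
    and carrier: "carrier G = range (\<lambda>i::nat. \<sigma> [^] i)" using G p0 by auto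
  have LG: "L \<subseteq> carrier G" using assms(6) subgroup.subset by blast
  then have finL: "finite L" using fin finite_subset by blast
  have "card L dvd p ^ 2" using lagrange[OF assms(6)] ord by (metis dvd_triv_right)
  then obtain i where i: "i \<le> 2" "card L = p ^ i" using assms(3) by (auto simp: divides_primepow_nat)
  have "i \<noteq> 0"
  proof
    assume "i = 0"
    then have "card L = 1" using i by simp
    then obtain a where "L = {a}" using card_1_singletonE by blast
    then show False using assms(7) subgroup.one_closed[OF assms(6)] by auto
  qed
  moreover have "i \<noteq> 2"
    using i ord assms(8) card_subset_eq[OF fin LG] by (auto simp: Coset.order_def)
  ultimately have cardL: "card L = p" using i by (cases "i = 1") auto
  have "L \<subseteq> range (\<lambda>k::nat. \<sigma> [^] (p * k))"
  proof
    fix g assume g: "g \<in> L"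
    then obtain i :: nat where gi: "g = \<sigma> [^] i" using LG carrier by blast
    interpret L: group "G\<lparr>carrier := L\<rparr>" using assms(6) subgroup_imp_group by blast
    have "g [^] p = g [^]\<^bsub>G\<lparr>carrier := L\<rparr>\<^esub> Coset.order (G\<lparr>carrier := L\<rparr>)"
      using cardL nat_pow_consistent[of g p L] by (simp add: Coset.order_def)
    also have "\<dots> = \<one>" using L.pow_order_eq_1[of g] g by simp
    finally have "g [^] p = \<one>" .
    then have "\<sigma> [^] (i * p) = \<one>" using gi assms(4) by (simp add: nat_pow_pow)
    then have "p ^ 2 dvd i * p" using pow_eq_id[OF assms(4)] ord by simp
    then have "p dvd i" using p0 by (simp add: power2_eq_square)
    then show "g \<in> range (\<lambda>k::nat. \<sigma> [^] (p * k))" using gi by auto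
  qed
  have sub: "range (\<lambda>k::nat. \<sigma> [^] (p * k)) \<subseteq> (\<lambda>k. \<sigma> [^] (p * k)) ` {..<p}"
  proof
    fix g assume "g \<in> range (\<lambda>k::nat. \<sigma> [^] (p * k))"
    then obtain k :: nat where "g = \<sigma> [^] (p * k)" by blast
    also have "p * k = p * (k mod p) + p ^ 2 * (k div p)"
    proof -
      have "p * k = p * (k mod p + p * (k div p))" by (simp only: mod_mult_div_eq)
      then show ?thesis by (simp only: distrib_left power2_eq_square mult.assoc)
    qed
    also have "\<sigma> [^] \<dots> = \<sigma> [^] (p * (k mod p)) \<otimes> (\<sigma> [^] (p ^ 2)) [^] (k div p)"
      using nat_pow_mult[OF assms(4)] nat_pow_pow[OF assms(4)] by (simp only:)
    also have "\<sigma> [^] (p ^ 2) = \<one>" using pow_eq_id[OF assms(4)] ord by simp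
    finally have "g = \<sigma> [^] (p * (k mod p))" using assms(4) by simp
    then show "g \<in> (\<lambda>k. \<sigma> [^] (p * k)) ` {..<p}" using p0 by auto
  qed
  have "L = (\<lambda>k. \<sigma> [^] (p * k)) ` {..<p}"
  proof (rule card_seteq)
    show "L \<subseteq> (\<lambda>k. \<sigma> [^] (p * k)) ` {..<p}" using \<open>L \<subseteq> range _\<close> sub by (rule subset_trans)
    show "card ((\<lambda>k. \<sigma> [^] (p * k)) ` {..<p}) \<le> card L" using cardL card_image_le[of "{..<p}"] by simp
  qed simp
  with sub \<open>L \<subseteq> range _\<close> show ?thesis by (intro equalityI) simp_all
qed

section \<open>The dual of a single unipotent block\<close>

lemma vector_space_dual_scale: "vector_space (dual_scale :: 'f::field \<Rightarrow> ('v \<Rightarrow> 'f) \<Rightarrow> _)"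
  by unfold_locales (auto simp: dual_scale_def fun_eq_iff algebra_simps)

lemma sum_fun_apply: "(\<Sum>i\<in>I. f i) a = (\<Sum>i\<in>I. f i a)"
  by (induction I rule: infinite_finite_induct) auto

text \<open>A linear map \<open>U\<close> that is inverse to a map with eigenvalue
  \<open>1\<close> and the spanning Jordan chain \<open>e\<close>. The inverse is what acts on
  functionals, by precomposition.\<close>

locale unipotent_block = vector_space scl
  for scl :: "'f::field \<Rightarrow> 'v::ab_group_add \<Rightarrow> 'v" +
  fixes U :: "'v \<Rightarrow> 'v" and e :: "nat \<Rightarrow> 'v" and n :: nat
  assumes linear_U: "Vector_Spaces.linear scl scl U"
    and U_e_1: "U (e 1) = e 1"
    and U_e_Suc: "i \<in> {1..<n} \<Longrightarrow> U (e (Suc i)) + U (e i) = e (Suc i)"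
    and span_e: "span (e ` {1..n}) = UNIV"
begin

sublocale U: Vector_Spaces.linear scl scl U by (rule linear_U)

definition Flag :: "nat \<Rightarrow> 'v set" where "Flag k = span (e ` {1..k})"

lemma subspace_Flag: "subspace (Flag k)"
  unfolding Flag_def by (rule subspace_span)

lemma Flag_n: "Flag n = UNIV"
  unfolding Flag_def by (rule span_e)

lemma e_in_Flag: "i \<in> {1..k} \<Longrightarrow> e i \<in> Flag k"
  by (auto simp: Flag_def intro: span_base)

lemma Flag_mono: "k \<le> l \<Longrightarrow> Flag k \<subseteq> Flag l"
  unfolding Flag_def by (intro span_mono image_mono) auto

lemma U_e_diff: "Suc i \<le> n \<Longrightarrow> U (e (Suc i)) - e (Suc i) \<in> Flag i"
proof (induction i)
  case 0
  then show ?case using U_e_1 by (simp add: Flag_def span_zero)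
next
  case (Suc i)
  have eq: "U (e (Suc (Suc i))) - e (Suc (Suc i)) = - (U (e (Suc i)) - e (Suc i)) - e (Suc i)"
    using U_e_Suc[of "Suc i"] Suc.prems by (simp add: algebra_simps)
  have "U (e (Suc i)) - e (Suc i) \<in> Flag (Suc i)"
    using Suc Flag_mono[of i "Suc i"] by auto
  moreover have "e (Suc i) \<in> Flag (Suc i)" by (rule e_in_Flag) auto
  ultimately show ?case unfolding eq
    by (rule subspace_diff[OF subspace_Flag subspace_neg[OF subspace_Flag]])
qed

lemma U_diff_Flag:
  assumes "v \<in> Flag (Suc k)" "Suc k \<le> n"
  shows "U v - v \<in> Flag k"
  using assms(1) unfolding Flag_def[of "Suc k"]
proof (induction rule: span_induct)
  case base
  show ?case
  proof (rule subspaceI, goal_cases)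
    case 1
    then show ?case using subspace_0[OF subspace_Flag] by (simp add: U.zero)
  next
    case (2 x y)
    have eq: "U (x + y) - (x + y) = (U x - x) + (U y - y)" by (simp add: U.add)
    show ?case unfolding mem_Collect_eq eq using 2 by (intro subspace_add subspace_Flag) auto
  next
    case (3 c x)
    have eq: "U (scl c x) - scl c x = scl c (U x - x)" by (simp add: U.scale scale_right_diff_distrib)
    show ?case unfolding mem_Collect_eq eq using 3 by (intro subspace_scale subspace_Flag) auto
  qed
next
  case (step v)
  then obtain i where i: "i \<in> {1..Suc k}" "v = e i" by auto
  then obtain j where j: "i = Suc j" by (cases i) auto
  then have "U v - v \<in> Flag j" using i assms(2) by (simp add: U_e_diff)
  then show ?case using Flag_mono[of j k] i j by auto
qed

definition \<Delta> :: "('v \<Rightarrow> 'f) \<Rightarrow> ('v \<Rightarrow> 'f)" where "\<Delta> \<phi> = (\<lambda>v. \<phi> (U v)) - \<phi>"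

lemma \<Delta>_apply:
  assumes "\<phi> \<in> dual_space scl"
  shows "\<Delta> \<phi> v = \<phi> (U v - v)"
proof -
  interpret \<phi>: Vector_Spaces.linear scl "(*)" \<phi> using assms by (simp add: dual_space_def)
  show ?thesis by (simp add: \<Delta>_def \<phi>.diff)
qed

lemma \<Delta>_dual: "\<phi> \<in> dual_space scl \<Longrightarrow> \<Delta> \<phi> \<in> dual_space scl"
proof -
  assume \<phi>: "\<phi> \<in> dual_space scl"
  interpret \<phi>: Vector_Spaces.linear scl "(*)" \<phi> using \<phi> by (simp add: dual_space_def)
  show ?thesis using \<phi> unfolding dual_space_def mem_Collect_eq Vector_Spaces.linear_iff
    by (auto simp: \<Delta>_def U.add U.scale algebra_simps)
qed

lemma \<Delta>_funpow_dual: "\<phi> \<in> dual_space scl \<Longrightarrow> (\<Delta> ^^ k) \<phi> \<in> dual_space scl"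
  by (induction k) (auto intro: \<Delta>_dual)

lemma \<Delta>_funpow_vanishes:
  assumes "\<phi> \<in> dual_space scl"
  shows "k \<le> n \<Longrightarrow> v \<in> Flag k \<Longrightarrow> (\<Delta> ^^ k) \<phi> v = 0"
proof (induction k arbitrary: v)
  case 0
  interpret \<phi>: Vector_Spaces.linear scl "(*)" \<phi> using assms by (simp add: dual_space_def)
  show ?case using 0 by (simp add: Flag_def \<phi>.zero)
next
  case (Suc k)
  then show ?case
    using \<Delta>_apply[OF \<Delta>_funpow_dual[OF assms, of k]] U_diff_Flag[of v k] by simp
qed

text \<open>Modulo \<open>Flag k\<close>, which the \<open>k\<close>-th power of
  \<open>\<Delta>\<close> kills, \<open>U - 1\<close> maps \<open>e (k + 2)\<close> to \<open>-
  e (k + 1)\<close>.\<close>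

lemma \<Delta>_funpow_nonzero:
  assumes "\<phi> \<in> dual_space scl" "\<phi> (e 1) \<noteq> 0"
  shows "Suc k \<le> n \<Longrightarrow> (\<Delta> ^^ k) \<phi> (e (Suc k)) \<noteq> 0"
proof (induction k)
  case 0
  then show ?case using assms by simp
next
  case (Suc k)
  let ?\<psi> = "(\<Delta> ^^ k) \<phi>"
  have \<psi>: "?\<psi> \<in> dual_space scl" using \<Delta>_funpow_dual assms by blast
  interpret \<psi>: Vector_Spaces.linear scl "(*)" ?\<psi> using \<psi> by (simp add: dual_space_def)
  have "U (e (Suc (Suc k))) - e (Suc (Suc k)) = - (U (e (Suc k)) - e (Suc k)) - e (Suc k)"
    using U_e_Suc[of "Suc k"] Suc.prems by (simp add: algebra_simps)
  then have "(\<Delta> ^^ Suc k) \<phi> (e (Suc (Suc k))) = ?\<psi> (- (U (e (Suc k)) - e (Suc k)) - e (Suc k))"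
    using \<Delta>_apply[OF \<psi>, of "e (Suc (Suc k))"] by (simp only: funpow.simps o_apply)
  also have "\<dots> = - ?\<psi> (U (e (Suc k)) - e (Suc k)) - ?\<psi> (e (Suc k))"
    by (simp only: \<psi>.diff \<psi>.neg)
  also have "?\<psi> (U (e (Suc k)) - e (Suc k)) = 0"
    using Suc.prems by (intro \<Delta>_funpow_vanishes assms U_e_diff) auto
  finally show ?case using Suc by simp
qed

lemma \<Delta>_funpow_n: "\<phi> \<in> dual_space scl \<Longrightarrow> (\<Delta> ^^ n) \<phi> = 0"
  by (rule ext) (simp add: \<Delta>_funpow_vanishes Flag_n)

text \<open>The values of the \<open>x i\<close> on the vectors \<open>e j\<close>, in reverse
  order, form a triangular matrix with nonzero diagonal.\<close>

lemma \<Delta>_basis: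
  assumes \<phi>: "\<phi> \<in> dual_space scl" "\<phi> (e 1) \<noteq> 0"
    and x: "\<And>i. i \<in> {1..n} \<Longrightarrow> x i = (\<Delta> ^^ (n - i)) \<phi>"
  shows "inj_on x {1..n}" "\<not> module.dependent dual_scale (x ` {1..n})"
proof -
  interpret dual: vector_space "dual_scale :: 'f \<Rightarrow> ('v \<Rightarrow> 'f) \<Rightarrow> _" by (rule vector_space_dual_scale)
  have diag: "x i (e (Suc (n - i))) \<noteq> 0" if "i \<in> {1..n}" for i
    unfolding x[OF that] using that by (intro \<Delta>_funpow_nonzero \<phi>) auto
  have below: "x j (e (Suc (n - i))) = 0" if "i \<in> {1..n}" "j \<in> {1..n}" "j < i" for i j
    unfolding x[OF that(2)] using that by (intro \<Delta>_funpow_vanishes \<phi>(1) e_in_Flag) auto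
  show inj: "inj_on x {1..n}"
  proof (rule linorder_inj_onI)
    fix i j assume "i < j" "i \<in> {1..n}" "j \<in> {1..n}"
    then show "x i \<noteq> x j" using diag[of j] below[of j i] by auto
  qed linarith
  show "\<not> dual.dependent (x ` {1..n})"
  proof
    assume "dual.dependent (x ` {1..n})"
    then obtain u where u: "\<exists>v\<in>x ` {1..n}. u v \<noteq> 0"
        "(\<Sum>v\<in>x ` {1..n}. dual_scale (u v) v) = 0"
      using dual.dependent_finite[of "x ` {1..n}"] by auto
    define I where "I = {i \<in> {1..n}. u (x i) \<noteq> 0}"
    have "finite I" "I \<noteq> {}" using u(1) by (auto simp: I_def)
    \<comment> \<open>At \<open>e (Suc (n - m))\<close> only the term with the largest index of the relation remains.\<close>
    define m where "m = Max I"
    have m: "m \<in> {1..n}" "u (x m) \<noteq> 0"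
      using Max_in[OF \<open>finite I\<close> \<open>I \<noteq> {}\<close>] by (auto simp: m_def I_def)
    have above: "u (x j) = 0" if "j \<in> {1..n}" "j > m" for j
    proof (rule ccontr)
      assume "u (x j) \<noteq> 0"
      then have "j \<le> m" unfolding m_def using that by (intro Max_ge \<open>finite I\<close>) (simp add: I_def)
      then show False using that by simp
    qed
    have "0 = (\<Sum>v\<in>x ` {1..n}. dual_scale (u v) v) (e (Suc (n - m)))" using u(2) by simp
    also have "\<dots> = (\<Sum>i\<in>{1..n}. u (x i) * x i (e (Suc (n - m))))"
      unfolding sum.reindex[OF inj] o_def sum_fun_apply dual_scale_def ..
    also have "\<dots> = (\<Sum>i\<in>{m}. u (x i) * x i (e (Suc (n - m))))"
    proof (intro sum.mono_neutral_right ballI)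
      fix i assume "i \<in> {1..n} - {m}"
      then show "u (x i) * x i (e (Suc (n - m))) = 0"
        using above[of i] below[OF m(1), of i] by (cases "i < m") auto
    qed (use m in auto)
    finally show False using m diag by simp
  qed
qed

end

section \<open>The action on the symmetric algebra\<close>

lemma sym_emb_linear:
  fixes x :: "nat \<Rightarrow> 'v \<Rightarrow> 'f::field"
  assumes "\<not> module.dependent dual_scale (x ` {1..n})" and inj: "inj_on x {1..n}"
  shows "i \<in> {1..n} \<Longrightarrow> sym_emb n x (x i) = X i"
    and "\<phi> \<in> module.span dual_scale (x ` {1..n}) \<Longrightarrow> \<psi> \<in> module.span dual_scale (x ` {1..n}) \<Longrightarrow>
      sym_emb n x (\<phi> + \<psi>) = sym_emb n x \<phi> + sym_emb n x \<psi>"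
    and "\<phi> \<in> module.span dual_scale (x ` {1..n}) \<Longrightarrow>
      sym_emb n x (dual_scale c \<phi>) = Const c * sym_emb n x \<phi>"
    and "sym_emb n x 0 = 0"
proof -
  interpret dual: vector_space "dual_scale :: 'f \<Rightarrow> ('v \<Rightarrow> 'f) \<Rightarrow> _" by (rule vector_space_dual_scale)
  note indep = assms(1)
  show "sym_emb n x (x i) = X i" if i: "i \<in> {1..n}"
  proof -
    have "sym_emb n x (x i) = (\<Sum>j=1..n. if j = i then X j else 0)"
      unfolding sym_emb_def
    proof (intro sum.cong refl)
      fix j assume j: "j \<in> {1..n}"
      have "dual.representation (x ` {1..n}) (x i) = (\<lambda>v. if v = x i then 1 else 0)"
        using i by (intro dual.representation_basis indep) auto
      moreover have "x j = x i \<longleftrightarrow> j = i" using inj i j by (auto dest: inj_onD)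
      ultimately show "Const (dual.representation (x ` {1..n}) (x i) (x j)) * X j =
          (if j = i then X j else 0)" by auto
    qed
    also have "\<dots> = X i" using i by simp
    finally show ?thesis .
  qed
  show "sym_emb n x (\<phi> + \<psi>) = sym_emb n x \<phi> + sym_emb n x \<psi>"
    if "\<phi> \<in> dual.span (x ` {1..n})" "\<psi> \<in> dual.span (x ` {1..n})"
    unfolding sym_emb_def dual.representation_add[OF indep that(2) that(1)] Const_hom distrib_right sum.distrib ..
  show "sym_emb n x (dual_scale c \<phi>) = Const c * sym_emb n x \<phi>"
    if "\<phi> \<in> dual.span (x ` {1..n})"
    unfolding sym_emb_def dual.representation_scale[OF indep that] Const_hom sum_distrib_left mult.assoc ..
  show "sym_emb n x 0 = 0"
    unfolding sym_emb_def dual.representation_zero by simp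
qed

text \<open>The generator of the dual module does not vanish on the fixed vector \<open>e
  1\<close>, since otherwise its whole orbit and hence every functional would. So the \<open>x
  i\<close> form a basis, on which \<open>\<sigma>\<close> acts by a Jordan block. Since
  \<open>sym_emb\<close> intertwines the actions of \<open>\<sigma>\<close> on functionals and
  on polynomials, the powers of \<open>\<sigma>\<close> act by the powers of this
  endomorphism.\<close>

lemma representation_jordan_action:
  fixes G (structure)
    and scl :: "'f::field \<Rightarrow> 'v::ab_group_add \<Rightarrow> 'v" and \<rho> :: "'g \<Rightarrow> 'v \<Rightarrow> 'v"
    and x :: "nat \<Rightarrow> 'v \<Rightarrow> 'f"
  assumes p: "prime p" "CHAR('f) = p"
    and "group G" and \<sigma>: "\<sigma> \<in> carrier G" "carrier G = range (\<lambda>i::nat. \<sigma> [^] i)"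
    and rep: "linear_rep G scl \<rho>" and block: "single_jordan_block scl (\<rho> \<sigma>) 1 (Suc p)"
    and gen: "dual_generator G scl \<rho> (x (Suc p))"
    and x: "\<And>i. i \<in> {1..p} \<Longrightarrow> x i = (Delta G \<rho> \<sigma> ^^ (Suc p - i)) (x (Suc p))"
  defines "act \<equiv> sym_act G \<rho> (Suc p) x"
  shows "jordan_action (act \<sigma>) p"
    and "f \<in> poly_ring (Suc p) \<Longrightarrow> act (\<sigma> [^] (k::nat)) f = (act \<sigma> ^^ k) f"
proof -
  interpret group G by fact
  interpret V: vector_space scl using rep by (simp add: linear_rep_def)
  interpret dual: vector_space "dual_scale :: 'f \<Rightarrow> ('v \<Rightarrow> 'f) \<Rightarrow> _" by (rule vector_space_dual_scale)
  have lin: "Vector_Spaces.linear scl scl (\<rho> g)" if "g \<in> carrier G" for g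
    using rep that by (simp add: linear_rep_def)
  have \<rho>_mult: "\<rho> (g \<otimes> h) v = \<rho> g (\<rho> h v)" if "g \<in> carrier G" "h \<in> carrier G" for g h v
    using rep that by (simp add: linear_rep_def)
  have \<rho>_one: "\<rho> \<one> v = v" for v using rep by (simp add: linear_rep_def)
  define U where "U = \<rho> (inv \<sigma>)"
  interpret U: Vector_Spaces.linear scl scl U unfolding U_def by (rule lin[OF inv_closed[OF \<sigma>(1)]])
  obtain e where e: "V.independent (e ` {1..Suc p})" "V.span (e ` {1..Suc p}) = UNIV"
      "\<And>i. i \<in> {1..Suc p} \<Longrightarrow> \<rho> \<sigma> (e i) = scl 1 (e i) + (if i = 1 then 0 else e (i - 1))"
    using block unfolding single_jordan_block_def by blast
  have \<rho>_e: "\<rho> \<sigma> (e 1) = e 1" "i \<in> {1..p} \<Longrightarrow> \<rho> \<sigma> (e (Suc i)) = e (Suc i) + e i" for i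
    using e(3)[of 1] e(3)[of "Suc i"] by auto
  have U_\<rho>: "U (\<rho> \<sigma> v) = v" for v
    unfolding U_def using \<rho>_mult[of "inv \<sigma>" \<sigma> v] \<sigma>(1) \<rho>_one by simp
  interpret block: unipotent_block scl U e "Suc p"
  proof
    show "U (e 1) = e 1" using U_\<rho>[of "e 1"] \<rho>_e(1) by simp
    show "U (e (Suc i)) + U (e i) = e (Suc i)" if "i \<in> {1..<Suc p}" for i
      using U_\<rho>[of "e (Suc i)"] \<rho>_e(2)[of i] that by (simp add: U.add)
  qed (fact e(2))
  have Delta: "Delta G \<rho> \<sigma> = block.\<Delta>"
    by (simp add: fun_eq_iff Delta_def block.\<Delta>_def dual_act_def flip: U_def)
  let ?\<phi> = "x (Suc p)"
  let ?S = "dual.span (x ` {1..Suc p})"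
  have \<phi>: "?\<phi> \<in> dual_space scl"
    and span_\<phi>: "dual.span ((\<lambda>g. dual_act G \<rho> g ?\<phi>) ` carrier G) = dual_space scl"
    using gen by (auto simp: dual_generator_def)
  have \<phi>_e1: "?\<phi> (e 1) \<noteq> 0"
  proof
    assume zero: "?\<phi> (e 1) = 0"
    have fix1: "\<rho> (\<sigma> [^] i) (e 1) = e 1" for i :: nat
      using \<sigma>(1) \<rho>_e(1) by (induction i) (simp_all only: nat_pow_0 nat_pow_Suc \<rho>_one \<rho>_mult nat_pow_closed)
    then have e1_fixed: "\<rho> g (e 1) = e 1" if "g \<in> carrier G" for g using that \<sigma>(2) by auto
    have "dual.span ((\<lambda>g. dual_act G \<rho> g ?\<phi>) ` carrier G) \<subseteq> {\<psi>. \<psi> (e 1) = 0}"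
    proof (rule dual.span_minimal)
      show "(\<lambda>g. dual_act G \<rho> g ?\<phi>) ` carrier G \<subseteq> {\<psi>. \<psi> (e 1) = 0}"
        using e1_fixed[OF inv_closed] zero by (auto simp only: dual_act_def)
      show "dual.subspace {\<psi>. \<psi> (e 1) = 0}"
        by (rule dual.subspaceI) (auto simp: dual_scale_def)
    qed
    then have vanish: "\<psi> (e 1) = 0" if "\<psi> \<in> dual_space scl" for \<psi> using span_\<phi> that by auto
    have "vector_space ((*) :: 'f \<Rightarrow> 'f \<Rightarrow> 'f)" by unfold_locales (auto simp: algebra_simps)
    then interpret pair: vector_space_pair scl "(*) :: 'f \<Rightarrow> 'f \<Rightarrow> 'f"
      using V.vector_space_axioms by (simp add: vector_space_pair_def)
    obtain \<psi> where "Vector_Spaces.linear scl (*) \<psi>" "\<forall>v\<in>e ` {1..Suc p}. \<psi> v = 1"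
      using pair.linear_independent_extend[OF e(1), of "\<lambda>_. 1"] by blast
    then show False using vanish[of \<psi>] by (auto simp: dual_space_def)
  qed
  have x_\<Delta>: "x i = (block.\<Delta> ^^ (Suc p - i)) ?\<phi>" if "i \<in> {1..Suc p}" for i
    using x[of i] that by (cases "i = Suc p") (auto simp: Delta)
  have indep: "dual.independent (x ` {1..Suc p})" and inj: "inj_on x {1..Suc p}"
    using block.\<Delta>_basis[OF \<phi> \<phi>_e1 x_\<Delta>] by auto
  note emb = sym_emb_linear[OF indep inj]
  have xS: "x i \<in> ?S" if "i \<in> {1..Suc p}" for i using that by (auto intro: dual.span_base)
  have \<Delta>_x: "block.\<Delta> (x 1) = 0" "i \<in> {1..p} \<Longrightarrow> block.\<Delta> (x (Suc i)) = x i" for i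
  proof -
    have "block.\<Delta> (x 1) = (block.\<Delta> ^^ Suc p) ?\<phi>" using x_\<Delta>[of 1] by simp
    then show "block.\<Delta> (x 1) = 0" using block.\<Delta>_funpow_n[OF \<phi>] by (simp only:)
    assume i: "i \<in> {1..p}"
    then have "Suc p - i = Suc (Suc p - Suc i)" by auto
    then show "block.\<Delta> (x (Suc i)) = x i" using x_\<Delta>[of i] x_\<Delta>[of "Suc i"] i by simp
  qed
  have act_x: "dual_act G \<rho> \<sigma> (x 1) = x 1" "i \<in> {1..p} \<Longrightarrow> dual_act G \<rho> \<sigma> (x (Suc i)) = x (Suc i) + x i" for i
  proof -
    have *: "dual_act G \<rho> \<sigma> \<psi> = \<psi> + block.\<Delta> \<psi>" for \<psi>
      by (simp add: Delta[symmetric] Delta_def)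
    show "dual_act G \<rho> \<sigma> (x 1) = x 1" unfolding * \<Delta>_x(1) by simp
    show "i \<in> {1..p} \<Longrightarrow> dual_act G \<rho> \<sigma> (x (Suc i)) = x (Suc i) + x i" unfolding * by (simp add: \<Delta>_x(2))
  qed
  have act_X: "act g (X i) = sym_emb (Suc p) x (dual_act G \<rho> g (x i))" for g i
    by (simp add: act_def sym_act_def)
  have alg: "alg_endo (act g)" for g unfolding act_def sym_act_def by (rule alg_endo_poly_subst)
  show jordan: "jordan_action (act \<sigma>) p"
  proof (intro jordan_action.intro alg jordan_action_axioms.intro p)
    show "act \<sigma> (X 1) = X 1" unfolding act_X act_x(1) by (rule emb(1)) auto
    fix i assume i: "i \<in> {1..p}"
    then have "act \<sigma> (X (Suc i)) = sym_emb (Suc p) x (x (Suc i)) + sym_emb (Suc p) x (x i)"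
      unfolding act_X act_x(2)[OF i] by (intro emb(2) xS) auto
    then show "act \<sigma> (X (Suc i)) = X (Suc i) + X i" using i by (simp add: emb(1))
  qed
  interpret s: alg_endo "act \<sigma>" by (rule alg)
  have equivariant: "dual_act G \<rho> \<sigma> \<psi> \<in> ?S \<and> sym_emb (Suc p) x (dual_act G \<rho> \<sigma> \<psi>) = act \<sigma> (sym_emb (Suc p) x \<psi>)"
    if "\<psi> \<in> ?S" for \<psi>
  proof -
    let ?W = "{\<psi> \<in> ?S. dual_act G \<rho> \<sigma> \<psi> \<in> ?S \<and> sym_emb (Suc p) x (dual_act G \<rho> \<sigma> \<psi>) = act \<sigma> (sym_emb (Suc p) x \<psi>)}"
    have "?S \<subseteq> ?W"
    proof (rule dual.span_minimal)
      show "x ` {1..Suc p} \<subseteq> ?W"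
      proof (intro image_subsetI CollectI conjI)
        fix i assume i: "i \<in> {1..Suc p}"
        then show "x i \<in> ?S" by (rule xS)
        show "dual_act G \<rho> \<sigma> (x i) \<in> ?S"
        proof (cases "i = 1")
          case True
          then show ?thesis unfolding True act_x(1) by (intro xS) auto
        next
          case False
          then obtain j where j: "i = Suc j" "j \<in> {1..p}" using i by (cases i) auto
          then show ?thesis unfolding j(1) act_x(2)[OF j(2)] by (intro dual.span_add xS) auto
        qed
        show "sym_emb (Suc p) x (dual_act G \<rho> \<sigma> (x i)) = act \<sigma> (sym_emb (Suc p) x (x i))"
          unfolding emb(1)[OF i] act_X ..
      qed
      have add: "dual_act G \<rho> \<sigma> (\<phi> + \<psi>) = dual_act G \<rho> \<sigma> \<phi> + dual_act G \<rho> \<sigma> \<psi>" for \<phi> \<psi> :: "'v \<Rightarrow> 'f"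
        by (simp add: dual_act_def fun_eq_iff)
      have scale: "dual_act G \<rho> \<sigma> (dual_scale c \<phi>) = dual_scale c (dual_act G \<rho> \<sigma> \<phi>)" for c and \<phi> :: "'v \<Rightarrow> 'f"
        by (simp add: dual_act_def dual_scale_def)
      have zero: "dual_act G \<rho> \<sigma> (0 :: 'v \<Rightarrow> 'f) = 0" by (simp add: dual_act_def fun_eq_iff)
      show "dual.subspace ?W"
      proof (rule dual.subspaceI)
        show "0 \<in> ?W" unfolding mem_Collect_eq zero emb(4) by (simp add: dual.span_zero)
      next
        fix \<phi> \<psi> assume "\<phi> \<in> ?W" "\<psi> \<in> ?W"
        then show "\<phi> + \<psi> \<in> ?W"
          unfolding mem_Collect_eq add by (metis (no_types, lifting) dual.span_add emb(2) s.add)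
      next
        fix c \<phi> assume "\<phi> \<in> ?W"
        then show "dual_scale c \<phi> \<in> ?W"
          unfolding mem_Collect_eq scale by (metis (no_types, lifting) dual.span_scale emb(3) s.mult s.Const)
      qed
    qed
    then show ?thesis using that by blast
  qed
  have power: "sym_emb (Suc p) x (dual_act G \<rho> (\<sigma> [^] k) \<psi>) = (act \<sigma> ^^ k) (sym_emb (Suc p) x \<psi>)"
    if "\<psi> \<in> ?S" for k :: nat and \<psi>
    using that
  proof (induction k arbitrary: \<psi>)
    case 0
    then show ?case by (simp add: dual_act_def \<rho>_one)
  next
    case (Suc k)
    have "dual_act G \<rho> (\<sigma> [^] Suc k) \<psi> = dual_act G \<rho> (\<sigma> [^] k) (dual_act G \<rho> \<sigma> \<psi>)"
      using \<sigma>(1) by (simp add: dual_act_def inv_mult_group \<rho>_mult)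
    then show ?case using Suc equivariant[OF Suc.prems] by (simp add: funpow_swap1)
  qed
  show "act (\<sigma> [^] k) f = (act \<sigma> ^^ k) f" if "f \<in> poly_ring (Suc p)"
  proof (rule alg_endo_eqI[OF alg s.alg_endo_funpow that])
    fix i assume i: "i \<in> {1..Suc p}"
    show "act (\<sigma> [^] k) (X i) = (act \<sigma> ^^ k) (X i)"
      unfolding act_X power[OF xS[OF i]] emb(1)[OF i] ..
  qed
qed

theorem theorem1p2:
  fixes p :: nat
    and G :: "('g, 'm) monoid_scheme" and L :: "'g set" and \<sigma> :: 'g
    and scl :: "'f::field \<Rightarrow> 'v::ab_group_add \<Rightarrow> 'v" and \<rho> :: "'g \<Rightarrow> 'v \<Rightarrow> 'v"
    and x :: "nat \<Rightarrow> 'v \<Rightarrow> 'f"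
    and act :: "'g \<Rightarrow> 'f polynomial \<Rightarrow> 'f polynomial"
  assumes "prime p" and "CHAR('f) = p"
    and "group G" and "G \<cong> integer_mod_group (p ^ 2)"
    and "\<sigma> \<in> carrier G" and "generate G {\<sigma>} = carrier G"
    and "subgroup L G" and "L \<noteq> {\<one>\<^bsub>G\<^esub>}" and "L \<noteq> carrier G"
    and "linear_rep G scl \<rho>" and "single_jordan_block scl (\<rho> \<sigma>) 1 (p + 1)"
    and "dual_generator G scl \<rho> (x (p + 1))"
    and "\<And>i. i \<in> {1..p} \<Longrightarrow> x i = (Delta G \<rho> \<sigma> ^^ (p + 1 - i)) (x (p + 1))"
    and "act = sym_act G \<rho> (p + 1) x"
  shows "invariants act (p + 1) (carrier G) =
    alg_gen ({orbit_norm act (carrier G) (X p), orbit_norm act (carrier G) (X (p + 1))} \<union>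
      rel_transfer G act p \<sigma> ` alg_gen (insert (orbit_norm act L (X (p + 1))) (X ` {1..p})))"
proof -
  define s where "s = act \<sigma>"
  have "p > 0" using assms(1) prime_gt_0_nat by blast
  then have carrier: "carrier G = range (\<lambda>i::nat. \<sigma> [^]\<^bsub>G\<^esub> i)"
    using cyclic_group_carrier(4)[OF assms(3,4) _ assms(5,6)] by simp
  have L: "L = range (\<lambda>k::nat. \<sigma> [^]\<^bsub>G\<^esub> (p * k))"
    using proper_subgroup_cyclic_group_prime_square[OF assms(3,4,1,5-9)] .
  note jordan = representation_jordan_action[OF assms(1-3,5) carrier assms(10) assms(11-13)[unfolded Suc_eq_plus1[symmetric]],
      folded assms(14)[unfolded Suc_eq_plus1[symmetric]] s_def]
  interpret jordan_action s p by (rule jordan(1))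
  have act: "act (\<sigma> [^]\<^bsub>G\<^esub> (k::nat)) f = (s ^^ k) f" if "f \<in> poly_ring (Suc p)" for k f
    by (rule jordan(2)[OF _ that])
  have X: "X p \<in> poly_ring (Suc p)" "X (Suc p) \<in> poly_ring (Suc p)"
    using \<open>p > 0\<close> by (auto intro: X_poly_ring)
  have "orbit_norm act (carrier G) (X p) = M"
    unfolding orbit_norm_def carrier image_image act[OF X(1)] by (rule prod_orbit_X_p)
  moreover have "orbit_norm act (carrier G) (X (Suc p)) = Q"
    unfolding orbit_norm_def carrier image_image act[OF X(2)] by (rule prod_orbit_t)
  moreover have "orbit_norm act L (X (Suc p)) = N"
    unfolding orbit_norm_def L image_image act[OF X(2)] by (rule prod_orbit_t_subgroup)
  moreover have "rel_transfer G act p \<sigma> ` BN = Tr ` BN"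
    using BN_subset by (intro image_cong refl) (auto simp: rel_transfer_def Tr_def act)
  moreover have "invariants act (Suc p) (carrier G) = {f \<in> poly_ring (Suc p). s f = f}"
  proof -
    have "(\<forall>g\<in>carrier G. act g f = f) \<longleftrightarrow> s f = f" if f: "f \<in> poly_ring (Suc p)" for f
    proof
      assume "\<forall>g\<in>carrier G. act g f = f"
      then show "s f = f" using assms(5) by (simp add: s_def)
    next
      assume "s f = f"
      then have "(s ^^ k) f = f" for k by (induction k) auto
      then show "\<forall>g\<in>carrier G. act g f = f" unfolding carrier by (auto simp: act[OF f])
    qed
    then show ?thesis unfolding invariants_def by blast
  qed
  ultimately show ?thesis using invariants_eq by (simp add: BN_def)
qed

end
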